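(* Let $M = \{(x,y,z) \in \mathbb{C}^3 : x y = z^2\}$ and consider on $M$ the vector fields $$\Theta = 2 z \frac{\partial}{\partial x} + y \frac{\partial}{\partial z}, \qquad \Xi = 2 z \frac{\partial}{\partial y} + x \frac{\partial}{\partial z}.$$ The subgroup of the algebraic automorphisms of $M$ generated by the flows of the locally nilpotent derivations $\Xi$, $\Theta$ and $x\,\Xi$ acts infinitely transitively on the regular locus of $M$.
   Context: The vector fields $\Theta$, $\Xi$, $x\,\Xi$ are tangent to $M$ and are regarded as derivations of the coordinate ring $\mathbb{C}[x,y,z]/(xy-z^2)$. The flow of a locally nilpotent derivation is the associated algebraic one-parameter unipotent subgroup of $\mathrm{Aut}(M)$ (all time-$t$ maps, $t \in \mathbb{C}$). The regular locus of $M$ is $M \setminus \{(0,0,0)\}$. A group $G$ acts infinitely transitively on a set $Y$ if for every $m \in \mathbb{N}$ it acts $m$-transitively, i.e. for any pairwise distinct $p_1,\dots,p_m \in Y$ and any pairwise distinct $q_1,\dots,q_m \in Y$ there is $F \in G$ with $F(p_j) = q_j$ for $j=1,\dots,m$. *)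

theory Defs
  imports
    Complex_Main
    "HOL-Computational_Algebra.Polynomial"
    "HOL-Algebra.Group_Action"
    "HOL-Algebra.Generated_Groups"
begin

section \<open>Polynomials in three variables\<close>

text \<open>
  The ring \<open>\<complex>[x,y,z]\<close> is the iterated polynomial ring \<open>\<complex>[x][y][z]\<close>: the outermost
  variable is \<open>z\<close>, the innermost one is \<open>x\<close>.
\<close>

type_synonym poly3 = "complex poly poly poly"

type_synonym point = "complex \<times> complex \<times> complex"

definition const3 :: "complex \<Rightarrow> poly3" where "const3 c = [:[:[:c:]:]:]"
definition X3 :: poly3 where "X3 = [:[:[:0, 1:]:]:]"
definition Y3 :: poly3 where "Y3 = [:[:0, 1:]:]"
definition Z3 :: poly3 where "Z3 = [:0, 1:]"

fun eval3 :: "poly3 \<Rightarrow> point \<Rightarrow> complex" where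
  "eval3 f (x, y, z) = poly (poly (poly f [:[:z:]:]) [:y:]) x"

definition diff_x :: "poly3 \<Rightarrow> poly3" where "diff_x = map_poly (map_poly pderiv)"
definition diff_y :: "poly3 \<Rightarrow> poly3" where "diff_y = map_poly pderiv"
definition diff_z :: "poly3 \<Rightarrow> poly3" where "diff_z = pderiv"

lemma eval3_const [simp]: "eval3 (const3 c) p = c"
  by (cases p) (simp add: const3_def)

lemma eval3_X [simp]: "eval3 X3 p = fst p"
  by (cases p) (simp add: X3_def)

lemma eval3_Y [simp]: "eval3 Y3 p = fst (snd p)"
  by (cases p) (simp add: Y3_def)

lemma eval3_Z [simp]: "eval3 Z3 p = snd (snd p)"
  by (cases p) (simp add: Z3_def)

lemma eval3_eq: "eval3 f p = poly (poly (poly f [:[:snd (snd p):]:]) [:fst (snd p):]) (fst p)"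
  by (cases p) simp

lemma eval3_ring [simp]:
  "eval3 0 p = 0" "eval3 1 p = 1"
  "eval3 (f + g) p = eval3 f p + eval3 g p"
  "eval3 (f - g) p = eval3 f p - eval3 g p"
  "eval3 (- f) p = - eval3 f p"
  "eval3 (f * g) p = eval3 f p * eval3 g p"
  by (simp_all add: eval3_eq)

declare eval3.simps [simp del]

lemma poly3_induct [case_names const X Y Z add mult]:
  fixes f :: poly3
  assumes c: "\<And>c. P (const3 c)" and X: "P X3" and Y: "P Y3" and Z: "P Z3"
    and add: "\<And>f g. P f \<Longrightarrow> P g \<Longrightarrow> P (f + g)"
    and mult: "\<And>f g. P f \<Longrightarrow> P g \<Longrightarrow> P (f * g)"
  shows "P f"
proof -
  have zero: "P 0" using c[of 0] by (simp add: const3_def)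
  have 1: "P [:[:q:]:]" for q
  proof (induction q)
    case 0
    show ?case using zero by simp
  next
    case (pCons a q)
    have "[:[:pCons a q:]:] = const3 a + X3 * [:[:q:]:]"
      by (simp add: const3_def X3_def)
    with pCons show ?case using c X add mult by metis
  qed
  have 2: "P [:q:]" for q
  proof (induction q)
    case 0
    show ?case using zero by simp
  next
    case (pCons a q)
    have "[:pCons a q:] = [:[:a:]:] + Y3 * [:q:]"
      by (simp add: Y3_def)
    with pCons show ?case using 1 Y add mult by metis
  qed
  show ?thesis
  proof (induction f)
    case 0
    show ?case using zero .
  next
    case (pCons a q)
    have "pCons a q = [:a:] + Z3 * q"
      by (simp add: Z3_def)
    with pCons show ?case using 2 Z add mult by metis
  qed
qed

lemma map_poly_derivation:
  fixes d :: "'a::comm_ring_1 \<Rightarrow> 'a"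
  assumes add: "\<And>a b. d (a + b) = d a + d b"
    and mult: "\<And>a b. d (a * b) = a * d b + b * d a"
  shows "map_poly d (p + q) = map_poly d p + map_poly d q"
    and "map_poly d (p * q) = p * map_poly d q + q * map_poly d p"
proof -
  have d0: "d 0 = 0" using add[of 0 0] by simp
  show A: "map_poly d (p + q) = map_poly d p + map_poly d q" for p q
    by (rule poly_eqI) (simp add: coeff_map_poly d0 add)
  have S: "map_poly d (smult a q) = smult a (map_poly d q) + smult (d a) q" for a q
    by (rule poly_eqI) (simp add: coeff_map_poly d0 mult algebra_simps)
  show "map_poly d (p * q) = p * map_poly d q + q * map_poly d p"
    by (induction p) (simp_all add: A S map_poly_pCons d0 algebra_simps)
qed

lemma diff_z_add: "diff_z (f + g) = diff_z f + diff_z g"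
  and diff_z_mult: "diff_z (f * g) = f * diff_z g + g * diff_z f"
  by (simp_all add: diff_z_def pderiv_add pderiv_mult)

lemma diff_y_add: "diff_y (f + g) = diff_y f + diff_y g"
  and diff_y_mult: "diff_y (f * g) = f * diff_y g + g * diff_y f"
  unfolding diff_y_def by (rule map_poly_derivation; simp add: pderiv_add pderiv_mult)+

lemma diff_x_add: "diff_x (f + g) = diff_x f + diff_x g"
  and diff_x_mult: "diff_x (f * g) = f * diff_x g + g * diff_x f"
  unfolding diff_x_def
  by (rule map_poly_derivation; rule map_poly_derivation; simp add: pderiv_add pderiv_mult)+

lemma diff_gens [simp]:
  "diff_x (const3 c) = 0" "diff_y (const3 c) = 0" "diff_z (const3 c) = 0"
  "diff_x X3 = 1" "diff_y X3 = 0" "diff_z X3 = 0"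
  "diff_x Y3 = 0" "diff_y Y3 = 1" "diff_z Y3 = 0"
  "diff_x Z3 = 0" "diff_y Z3 = 0" "diff_z Z3 = 1"
  by (simp_all add: diff_x_def diff_y_def diff_z_def const3_def X3_def Y3_def Z3_def
      map_poly_pCons pderiv_pCons one_pCons)

definition Theta3 :: "poly3 \<Rightarrow> poly3" where
  "Theta3 f = 2 * Z3 * diff_x f + Y3 * diff_z f"

definition Xi3 :: "poly3 \<Rightarrow> poly3" where
  "Xi3 f = 2 * Z3 * diff_y f + X3 * diff_z f"

lemma Theta3_add: "Theta3 (f + g) = Theta3 f + Theta3 g"
  and Theta3_mult: "Theta3 (f * g) = f * Theta3 g + g * Theta3 f"
  by (simp_all add: Theta3_def diff_x_add diff_z_add diff_x_mult diff_z_mult algebra_simps)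

lemma Xi3_add: "Xi3 (f + g) = Xi3 f + Xi3 g"
  and Xi3_mult: "Xi3 (f * g) = f * Xi3 g + g * Xi3 f"
  by (simp_all add: Xi3_def diff_y_add diff_z_add diff_y_mult diff_z_mult algebra_simps)

lemma Theta3_diff: "Theta3 (f - g) = Theta3 f - Theta3 g"
  using Theta3_add[of "f - g" g] by (simp add: eq_diff_eq)

lemma Xi3_diff: "Xi3 (f - g) = Xi3 f - Xi3 g"
  using Xi3_add[of "f - g" g] by (simp add: eq_diff_eq)


section \<open>The variety and its coordinate ring\<close>

definition M :: "point set" where
  "M = {(x, y, z). x * y = z\<^sup>2}"

definition regular_locus :: "point set" where
  "regular_locus = M - {(0, 0, 0)}"

definition M_eq :: poly3 where "M_eq = X3 * Y3 - Z3\<^sup>2"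

lemma eval3_M_eq: "p \<in> M \<Longrightarrow> eval3 M_eq p = 0"
  by (cases p) (simp add: M_def M_eq_def power2_eq_square)

text \<open>The ring \<open>\<complex>[x,y,z]/(xy - z\<^sup>2)\<close>.\<close>

quotient_type coord_ring = poly3 / "\<lambda>f g. M_eq dvd f - g"
proof (rule equivpI)
  show "reflp (\<lambda>f g. M_eq dvd f - g)" by (simp add: reflp_def)
  show "symp (\<lambda>f g. M_eq dvd f - g)"
  proof (rule sympI)
    fix f g assume "M_eq dvd f - g"
    then have "M_eq dvd - (f - g)" by (simp only: dvd_minus_iff)
    then show "M_eq dvd g - f" by (simp only: minus_diff_eq)
  qed
  show "transp (\<lambda>f g. M_eq dvd f - g)"
  proof (rule transpI)
    fix f g h assume "M_eq dvd f - g" "M_eq dvd g - h"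
    then have "M_eq dvd (f - g) + (g - h)" by (rule dvd_add)
    then show "M_eq dvd f - h" by simp
  qed
qed

instantiation coord_ring :: comm_ring_1
begin

lift_definition zero_coord_ring :: coord_ring is 0 .
lift_definition one_coord_ring :: coord_ring is 1 .
lift_definition plus_coord_ring :: "coord_ring \<Rightarrow> coord_ring \<Rightarrow> coord_ring" is "(+)"
proof -
  fix a b c d :: poly3
  assume "M_eq dvd a - b" "M_eq dvd c - d"
  then have "M_eq dvd (a - b) + (c - d)" by (rule dvd_add)
  then show "M_eq dvd (a + c) - (b + d)" by (simp only: add_diff_add)
qed

lift_definition minus_coord_ring :: "coord_ring \<Rightarrow> coord_ring \<Rightarrow> coord_ring" is "(-)"
proof -
  fix a b c d :: poly3
  assume "M_eq dvd a - b" "M_eq dvd c - d"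
  then have "M_eq dvd (a - b) - (c - d)" by (rule dvd_diff)
  moreover have "(a - b) - (c - d) = (a - c) - (b - d)" by simp
  ultimately show "M_eq dvd (a - c) - (b - d)" by (simp only:)
qed

lift_definition uminus_coord_ring :: "coord_ring \<Rightarrow> coord_ring" is uminus
proof -
  fix a b :: poly3
  assume "M_eq dvd a - b"
  then have "M_eq dvd - (a - b)" by (simp only: dvd_minus_iff)
  then show "M_eq dvd - a - - b" by simp
qed

lift_definition times_coord_ring :: "coord_ring \<Rightarrow> coord_ring \<Rightarrow> coord_ring" is "(*)"
proof -
  fix a b c d :: poly3
  assume "M_eq dvd a - b" "M_eq dvd c - d"
  moreover have "a * c - b * d = (a - b) * c + b * (c - d)" by (simp add: algebra_simps)
  ultimately show "M_eq dvd a * c - b * d" by simp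
qed

instance
proof
  show "(0::coord_ring) \<noteq> 1"
  proof (transfer, rule notI)
    assume "M_eq dvd 0 - 1"
    then obtain h where h: "0 - 1 = M_eq * h" by (elim dvdE)
    have "eval3 (0 - 1) (0, 0, 0) = eval3 (M_eq * h) (0, 0, 0)" by (simp only: h)
    moreover have "(0, 0, 0) \<in> M" by (simp add: M_def)
    ultimately show False by (simp add: eval3_M_eq)
  qed
next
  fix a b c :: coord_ring
  show "a * b * c = a * (b * c)" by transfer (simp add: mult.assoc)
  show "a * b = b * a" by transfer (simp add: mult.commute)
  show "1 * a = a" by transfer simp
  show "a + b + c = a + (b + c)" by transfer (simp add: add.assoc)
  show "a + b = b + a" by transfer (simp add: add.commute)
  show "0 + a = a" by transfer simp
  show "- a + a = 0" by transfer simp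
  show "a - b = a + - b" by transfer simp
  show "(a + b) * c = a * c + b * c" by transfer (simp add: distrib_right)
qed

end

lift_definition cconst :: "complex \<Rightarrow> coord_ring" is const3 .
lift_definition cx :: coord_ring is X3 .
lift_definition cy :: coord_ring is Y3 .
lift_definition cz :: coord_ring is Z3 .

text \<open>Elements of the coordinate ring are functions on \<open>M\<close> only, so the value is left
  undefined elsewhere.\<close>

lift_definition eval :: "coord_ring \<Rightarrow> point \<Rightarrow> complex" is "\<lambda>f. restrict (eval3 f) M"
proof (rule restrict_ext)
  fix f g :: poly3 and p
  assume "M_eq dvd f - g" and p: "p \<in> M"
  then obtain h where "f - g = M_eq * h" by (elim dvdE)
  then have "eval3 (f - g) p = 0" using p by (simp add: eval3_M_eq)
  then show "eval3 f p = eval3 g p" by simp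
qed

lemma eval_simps [simp]:
  assumes "p \<in> M"
  shows "eval (cconst c) p = c" "eval cx p = fst p" "eval cy p = fst (snd p)"
    "eval cz p = snd (snd p)" "eval 0 p = 0" "eval 1 p = 1"
    "eval (f + g) p = eval f p + eval g p" "eval (f - g) p = eval f p - eval g p"
    "eval (- f) p = - eval f p" "eval (f * g) p = eval f p * eval g p"
proof -
  show "eval (cconst c) p = c" using assms by transfer simp
  show "eval cx p = fst p" using assms by transfer simp
  show "eval cy p = fst (snd p)" using assms by transfer simp
  show "eval cz p = snd (snd p)" using assms by transfer simp
  show "eval 0 p = 0" using assms by transfer simp
  show "eval 1 p = 1" using assms by transfer simp
  show "eval (f + g) p = eval f p + eval g p" using assms by transfer simp
  show "eval (f - g) p = eval f p - eval g p" using assms by transfer simp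
  show "eval (- f) p = - eval f p" using assms by transfer simp
  show "eval (f * g) p = eval f p * eval g p" using assms by transfer simp
qed

lemma coord_ring_induct [case_names const x y z add mult]:
  assumes "\<And>c. P (cconst c)" "P cx" "P cy" "P cz"
    and "\<And>f g. P f \<Longrightarrow> P g \<Longrightarrow> P (f + g)"
    and "\<And>f g. P f \<Longrightarrow> P g \<Longrightarrow> P (f * g)"
  shows "P f"
proof -
  have "P (abs_coord_ring q)" for q
  proof (induction q rule: poly3_induct)
    case (const c)
    show ?case using assms(1)[of c] by (simp add: cconst.abs_eq)
  next
    case X
    show ?case using assms(2) by (simp add: cx_def)
  next
    case Y
    show ?case using assms(3) by (simp add: cy_def)
  next
    case Z
    show ?case using assms(4) by (simp add: cz_def)
  next
    case (add f g)
    then show ?case using assms(5) plus_coord_ring.abs_eq by metis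
  next
    case (mult f g)
    then show ?case using assms(6) times_coord_ring.abs_eq by metis
  qed
  from this[of "rep_coord_ring f"] show ?thesis
    by (simp only: Quotient_abs_rep[OF Quotient_coord_ring])
qed


section \<open>Derivations\<close>

definition derivation :: "(coord_ring \<Rightarrow> coord_ring) \<Rightarrow> bool" where
  "derivation D \<longleftrightarrow>
     (\<forall>f g. D (f + g) = D f + D g) \<and>
     (\<forall>c f. D (cconst c * f) = cconst c * D f) \<and>
     (\<forall>f g. D (f * g) = f * D g + g * D f)"

definition locally_nilpotent :: "(coord_ring \<Rightarrow> coord_ring) \<Rightarrow> bool" where
  "locally_nilpotent D \<longleftrightarrow> (\<forall>f. \<exists>n. (D ^^ n) f = 0)"

text \<open>The vector fields descend to the coordinate ring because they annihilate \<open>xy - z\<^sup>2\<close>,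
  i.e. because they are tangent to \<open>M\<close>.\<close>

lift_definition Theta :: "coord_ring \<Rightarrow> coord_ring" is Theta3
proof -
  fix f g :: poly3
  assume "M_eq dvd f - g"
  then obtain h where h: "f = M_eq * h + g" by (elim dvdE) (simp only: diff_eq_eq)
  have "Theta3 M_eq = Theta3 (X3 * Y3) - Theta3 (Z3 * Z3)"
    unfolding M_eq_def power2_eq_square by (rule Theta3_diff)
  also have "\<dots> = 0" unfolding Theta3_mult by (simp add: Theta3_def)
  finally show "M_eq dvd Theta3 f - Theta3 g" by (simp add: h Theta3_add Theta3_mult)
qed

lift_definition Xi :: "coord_ring \<Rightarrow> coord_ring" is Xi3
proof -
  fix f g :: poly3
  assume "M_eq dvd f - g"
  then obtain h where h: "f = M_eq * h + g" by (elim dvdE) (simp only: diff_eq_eq)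
  have "Xi3 M_eq = Xi3 (X3 * Y3) - Xi3 (Z3 * Z3)"
    unfolding M_eq_def power2_eq_square by (rule Xi3_diff)
  also have "\<dots> = 0" unfolding Xi3_mult by (simp add: Xi3_def)
  finally show "M_eq dvd Xi3 f - Xi3 g" by (simp add: h Xi3_add Xi3_mult)
qed

definition x_Xi :: "coord_ring \<Rightarrow> coord_ring" where
  "x_Xi f = cx * Xi f"

lemma Theta_gens [simp]:
  "Theta (cconst c) = 0" "Theta cx = 2 * cz" "Theta cy = 0" "Theta cz = cy"
proof -
  show "Theta (cconst c) = 0" by transfer (simp add: Theta3_def)
  have "Theta cx = cz + cz" by transfer (simp add: Theta3_def)
  then show "Theta cx = 2 * cz" by simp
  have "Theta cy = 0" by transfer (simp add: Theta3_def)
  then show "Theta cy = 0" by simp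
  show "Theta cz = cy" by transfer (simp add: Theta3_def)
qed

lemma Xi_gens [simp]:
  "Xi (cconst c) = 0" "Xi cx = 0" "Xi cy = 2 * cz" "Xi cz = cx"
proof -
  show "Xi (cconst c) = 0" by transfer (simp add: Xi3_def)
  have "Xi cx = 0" by transfer (simp add: Xi3_def)
  then show "Xi cx = 0" by simp
  have "Xi cy = cz + cz" by transfer (simp add: Xi3_def)
  then show "Xi cy = 2 * cz" by simp
  show "Xi cz = cx" by transfer (simp add: Xi3_def)
qed

lemma derivation_Theta: "derivation Theta"
proof -
  have "Theta (f + g) = Theta f + Theta g" for f g
    by transfer (simp add: Theta3_add)
  moreover have *: "Theta (f * g) = f * Theta g + g * Theta f" for f g
    by transfer (simp add: Theta3_mult)
  ultimately show ?thesis by (auto simp: derivation_def * )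
qed

lemma derivation_Xi: "derivation Xi"
proof -
  have "Xi (f + g) = Xi f + Xi g" for f g
    by transfer (simp add: Xi3_add)
  moreover have *: "Xi (f * g) = f * Xi g + g * Xi f" for f g
    by transfer (simp add: Xi3_mult)
  ultimately show ?thesis by (auto simp: derivation_def * )
qed

lemma derivation_x_Xi: "derivation x_Xi"
  using derivation_Xi by (auto simp: derivation_def x_Xi_def algebra_simps)

lemma derivation_add: "derivation D \<Longrightarrow> D (f + g) = D f + D g"
  unfolding derivation_def by blast

lemma derivation_mult: "derivation D \<Longrightarrow> D (f * g) = f * D g + g * D f"
  unfolding derivation_def by blast

lemma derivation_one: "derivation D \<Longrightarrow> D 1 = 0"
  using derivation_mult[of D 1 1] by simp

lemma derivation_two: "derivation D \<Longrightarrow> D 2 = 0"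
  using derivation_add[of D 1 1] derivation_one[of D] by simp

lemma derivation_pow_0: "derivation D \<Longrightarrow> (D ^^ n) 0 = 0"
proof -
  assume "derivation D"
  then have "D (0 + 0) = D 0 + D 0" unfolding derivation_def by blast
  then show ?thesis by (induction n) simp_all
qed

lemma derivation_pow_add: "derivation D \<Longrightarrow> (D ^^ n) (f + g) = (D ^^ n) f + (D ^^ n) g"
  by (induction n) (simp_all add: derivation_add)

lemma derivation_pow_mono: "derivation D \<Longrightarrow> (D ^^ m) f = 0 \<Longrightarrow> m \<le> n \<Longrightarrow> (D ^^ n) f = 0"
  by (metis derivation_pow_0 funpow_add comp_apply le_add_diff_inverse2)

lemma derivation_nil_add:
  assumes D: "derivation D" and "\<exists>n. (D ^^ n) f = 0" "\<exists>n. (D ^^ n) g = 0"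
  shows "\<exists>n. (D ^^ n) (f + g) = 0"
proof -
  from assms obtain m n where "(D ^^ m) f = 0" "(D ^^ n) g = 0" by blast
  then have "(D ^^ max m n) (f + g) = 0"
    using derivation_pow_mono[OF D] by (simp add: derivation_pow_add[OF D])
  then show ?thesis by blast
qed

lemma derivation_nil_mult:
  assumes D: "derivation D" and "(D ^^ m) f = 0" "(D ^^ n) g = 0"
  shows "\<exists>k. (D ^^ k) (f * g) = 0"
  using assms(2,3)
proof (induction "m + n" arbitrary: m n f g rule: less_induct)
  case less
  show ?case
  proof (cases "m = 0 \<or> n = 0")
    case True
    then have "f * g = 0" using less.prems by auto
    then show ?thesis using derivation_pow_0[OF D] by auto
  next
    case False
    then obtain m' n' where [simp]: "m = Suc m'" "n = Suc n'"
      by (meson not0_implies_Suc)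
    have "\<exists>k. (D ^^ k) (f * D g) = 0"
      using less.prems by (intro less.hyps[of m n']) (auto simp: funpow_Suc_right simp del: funpow.simps)
    moreover have "\<exists>k. (D ^^ k) (g * D f) = 0"
      using less.prems by (intro less.hyps[of n m']) (auto simp: funpow_Suc_right simp del: funpow.simps)
    moreover have "D (f * g) = f * D g + g * D f" using D by (auto simp: derivation_def)
    ultimately obtain k where "(D ^^ k) (D (f * g)) = 0"
      using derivation_nil_add[OF D] by metis
    then have "(D ^^ Suc k) (f * g) = 0" by (simp add: funpow_Suc_right del: funpow.simps)
    then show ?thesis by blast
  qed
qed

lemma locally_nilpotentI:
  assumes D: "derivation D"
    and gens: "\<exists>n. (D ^^ n) cx = 0" "\<exists>n. (D ^^ n) cy = 0" "\<exists>n. (D ^^ n) cz = 0"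
  shows "locally_nilpotent D"
  unfolding locally_nilpotent_def
proof
  fix f
  show "\<exists>n. (D ^^ n) f = 0"
  proof (induction f rule: coord_ring_induct)
    case (const c)
    have "D (1 * 1) = 1 * D 1 + 1 * D 1" using D unfolding derivation_def by blast
    then have "D 1 = 0" by simp
    moreover have "D (cconst c * 1) = cconst c * D 1" using D unfolding derivation_def by blast
    ultimately have "(D ^^ 1) (cconst c) = 0" by simp
    then show ?case by blast
  next
    case (mult f g)
    then show ?case using derivation_nil_mult[OF D] by blast
  qed (use gens derivation_nil_add[OF D] in blast)+
qed

lemma derivation_zero: "derivation D \<Longrightarrow> D 0 = 0"
  using derivation_pow_0[of D 1] by simp

lemma locally_nilpotent_Theta: "locally_nilpotent Theta"
proof (rule locally_nilpotentI[OF derivation_Theta])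
  note s = numeral_3_eq_3 derivation_two[OF derivation_Theta]
    derivation_mult[OF derivation_Theta] derivation_add[OF derivation_Theta] derivation_zero[OF derivation_Theta]
  have "(Theta ^^ 3) cx = 0" "(Theta ^^ 3) cy = 0" "(Theta ^^ 3) cz = 0"
    by (simp_all add: s)
  then show "\<exists>n. (Theta ^^ n) cx = 0" "\<exists>n. (Theta ^^ n) cy = 0" "\<exists>n. (Theta ^^ n) cz = 0"
    by blast+
qed

lemma locally_nilpotent_Xi: "locally_nilpotent Xi"
proof (rule locally_nilpotentI[OF derivation_Xi])
  note s = numeral_3_eq_3 derivation_two[OF derivation_Xi] derivation_zero[OF derivation_Xi]
    derivation_mult[OF derivation_Xi] derivation_add[OF derivation_Xi]
  have "(Xi ^^ 3) cx = 0" "(Xi ^^ 3) cy = 0" "(Xi ^^ 3) cz = 0"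
    by (simp_all add: s)
  then show "\<exists>n. (Xi ^^ n) cx = 0" "\<exists>n. (Xi ^^ n) cy = 0" "\<exists>n. (Xi ^^ n) cz = 0"
    by blast+
qed

lemma locally_nilpotent_x_Xi: "locally_nilpotent x_Xi"
proof (rule locally_nilpotentI[OF derivation_x_Xi])
  note s = numeral_3_eq_3 derivation_two[OF derivation_Xi] derivation_zero[OF derivation_Xi]
    derivation_mult[OF derivation_Xi] derivation_add[OF derivation_Xi] x_Xi_def
  have "(x_Xi ^^ 3) cx = 0" "(x_Xi ^^ 3) cy = 0" "(x_Xi ^^ 3) cz = 0"
    by (simp_all add: s)
  then show "\<exists>n. (x_Xi ^^ n) cx = 0" "\<exists>n. (x_Xi ^^ n) cy = 0" "\<exists>n. (x_Xi ^^ n) cz = 0"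
    by blast+
qed


section \<open>Algebraic automorphisms and flows\<close>

text \<open>A self-map of the affine variety \<open>M\<close> is a morphism iff it pulls regular functions
  back to regular functions.\<close>

definition morphism :: "(point \<Rightarrow> point) \<Rightarrow> bool" where
  "morphism F \<longleftrightarrow> F \<in> M \<rightarrow> M \<and> (\<forall>f. \<exists>g. \<forall>p\<in>M. eval g p = eval f (F p))"

text \<open>Automorphisms are functions on the whole type of points; as in \<^const>\<open>Bij\<close>, they are
  normalised to be \<^const>\<open>undefined\<close> outside \<open>M\<close>.\<close>

definition algebraic_automorphisms :: "(point \<Rightarrow> point) set" where
  "algebraic_automorphisms = {F \<in> Bij M. morphism F \<and> morphism (inv_into M F)}"

definition Aut_M :: "(point \<Rightarrow> point) monoid" where
  "Aut_M = BijGroup M\<lparr>carrier := algebraic_automorphisms\<rparr>"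

lemma subgroup_algebraic_automorphisms: "subgroup algebraic_automorphisms (BijGroup M)"
proof -
  have cong: "morphism F \<longleftrightarrow> morphism G" if "\<And>p. p \<in> M \<Longrightarrow> F p = G p" for F G
    using that by (auto simp: morphism_def Pi_iff)
  have comp: "morphism (compose M F G)" if "morphism F" "morphism G" for F G
    unfolding morphism_def
  proof (intro conjI allI)
    show "compose M F G \<in> M \<rightarrow> M" using that by (auto simp: morphism_def compose_def)
    fix f
    obtain g where g: "\<forall>p\<in>M. eval g p = eval f (F p)"
      using \<open>morphism F\<close> unfolding morphism_def by blast
    obtain h where "\<forall>p\<in>M. eval h p = eval g (G p)"
      using \<open>morphism G\<close> unfolding morphism_def by blast
    moreover have "G p \<in> M" if "p \<in> M" for p
      using \<open>morphism G\<close> that by (auto simp: morphism_def)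
    ultimately show "\<exists>h. \<forall>p\<in>M. eval h p = eval f (compose M F G p)"
      using g by (auto simp: compose_def)
  qed
  show ?thesis
  proof
    show "algebraic_automorphisms \<subseteq> carrier (BijGroup M)"
      by (auto simp: algebraic_automorphisms_def BijGroup_def)
  next
    fix F G assume F: "F \<in> algebraic_automorphisms" and G: "G \<in> algebraic_automorphisms"
    then have B: "F \<in> Bij M" "G \<in> Bij M" by (auto simp: algebraic_automorphisms_def)
    have "inv_into M (compose M F G) p = compose M (inv_into M G) (inv_into M F) p"
      if p: "p \<in> M" for p
    proof (rule inv_into_f_eq)
      show "inj_on (compose M F G) M" using compose_Bij[OF B] by (simp add: Bij_def bij_betw_def)
      show "compose M (inv_into M G) (inv_into M F) p \<in> M"
        using p B by (simp add: compose_def Bij_inv_into_mem)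
      show "compose M F G (compose M (inv_into M G) (inv_into M F) p) = p"
        using p B Bij_inv_into_mem[OF B(1) p] Bij_inv_into_mem[OF B(2)]
        by (simp add: compose_def Bij_def bij_betw_inv_into_right[of F M M]
            bij_betw_inv_into_right[of G M M])
    qed
    then have "morphism (inv_into M (compose M F G))"
      using F G comp cong unfolding algebraic_automorphisms_def by (metis (no_types, lifting) mem_Collect_eq)
    moreover have "morphism (compose M F G)"
      using F G comp by (auto simp: algebraic_automorphisms_def)
    ultimately show "F \<otimes>\<^bsub>BijGroup M\<^esub> G \<in> algebraic_automorphisms"
      using B by (simp add: algebraic_automorphisms_def BijGroup_def compose_Bij)
  next
    have id: "morphism (\<lambda>p\<in>M. p)" by (auto simp: morphism_def)
    have "inv_into M (\<lambda>p\<in>M. p) p = (\<lambda>p\<in>M. p) p" if "p \<in> M" for p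
      by (rule inv_into_f_eq) (use that in \<open>auto simp: inj_on_def\<close>)
    then have "morphism (inv_into M (\<lambda>p\<in>M. p))" using id cong by metis
    then show "\<one>\<^bsub>BijGroup M\<^esub> \<in> algebraic_automorphisms"
      using id id_Bij by (simp add: algebraic_automorphisms_def BijGroup_def)
  next
    fix F assume F: "F \<in> algebraic_automorphisms"
    then have B: "F \<in> Bij M" by (auto simp: algebraic_automorphisms_def)
    let ?G = "restrict (inv_into M F) M"
    have GB: "?G \<in> Bij M" by (rule restrict_inv_into_Bij[OF B])
    have "inv_into M ?G p = F p" if p: "p \<in> M" for p
    proof (rule inv_into_f_eq)
      show "inj_on ?G M" using GB by (simp add: Bij_def bij_betw_def)
      show "F p \<in> M" using B p Bij_imp_funcset by blast
      then show "?G (F p) = p" using B p by (simp add: Bij_def bij_betw_def)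
    qed
    then have "morphism (inv_into M ?G)"
      using F cong unfolding algebraic_automorphisms_def by (metis (no_types, lifting) mem_Collect_eq)
    moreover have "morphism ?G \<longleftrightarrow> morphism (inv_into M F)" by (rule cong) simp
    ultimately have "?G \<in> algebraic_automorphisms"
      using F GB by (simp add: algebraic_automorphisms_def)
    then show "inv\<^bsub>BijGroup M\<^esub> F \<in> algebraic_automorphisms"
      by (simp add: inv_BijGroup[OF B])
  qed
qed

lemma group_Aut_M: "group Aut_M"
  unfolding Aut_M_def
  by (rule subgroup.subgroup_is_group[OF subgroup_algebraic_automorphisms group_BijGroup])

text \<open>The operator \<open>exp (t D) = (\<Sum>n. t\<^sup>n / n! D\<^sup>n)\<close>; for locally nilpotent \<open>D\<close> only
  finitely many terms of the series are non-zero.\<close>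

definition exp_derivation :: "complex \<Rightarrow> (coord_ring \<Rightarrow> coord_ring) \<Rightarrow> coord_ring \<Rightarrow> coord_ring" where
  "exp_derivation t D f = (\<Sum>n | (D ^^ n) f \<noteq> 0. cconst (t ^ n / fact n) * (D ^^ n) f)"

lemma locally_nilpotent_finite:
  assumes "derivation D" "locally_nilpotent D"
  shows "finite {n. (D ^^ n) f \<noteq> 0}"
proof -
  obtain m where "(D ^^ m) f = 0" using assms(2) by (auto simp: locally_nilpotent_def)
  then have "{n. (D ^^ n) f \<noteq> 0} \<subseteq> {..<m}"
    using derivation_pow_mono[OF assms(1)] by (auto simp: not_less[symmetric])
  then show ?thesis by (rule finite_subset) simp
qed

text \<open>The time-\<open>t\<close> map of \<open>D\<close> is the automorphism of \<open>M\<close> whose comorphism is \<open>exp (t D)\<close>.\<close>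

definition flow :: "(coord_ring \<Rightarrow> coord_ring) \<Rightarrow> (point \<Rightarrow> point) set" where
  "flow D = {F \<in> carrier Aut_M. \<exists>t. \<forall>f. \<forall>p\<in>M. eval f (F p) = eval (exp_derivation t D f) p}"


section \<open>Infinite transitivity\<close>

definition multiply_transitive ::
    "nat \<Rightarrow> ('g, 'b) monoid_scheme \<Rightarrow> 'a set \<Rightarrow> ('g \<Rightarrow> 'a \<Rightarrow> 'a) \<Rightarrow> bool" where
  "multiply_transitive m G E \<phi> \<longleftrightarrow>
     (\<forall>p q. p \<in> {1..m} \<rightarrow> E \<and> inj_on p {1..m} \<and> q \<in> {1..m} \<rightarrow> E \<and> inj_on q {1..m} \<longrightarrow>
        (\<exists>g\<in>carrier G. \<forall>j\<in>{1..m}. \<phi> g (p j) = q j))"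

definition infinitely_transitive_action ::
    "('g, 'b) monoid_scheme \<Rightarrow> 'a set \<Rightarrow> ('g \<Rightarrow> 'a \<Rightarrow> 'a) \<Rightarrow> bool" where
  "infinitely_transitive_action G E \<phi> \<longleftrightarrow>
     group_action G E \<phi> \<and> (\<forall>m. multiply_transitive m G E \<phi>)"

end

theory Submission
  imports Defs "HOL-Computational_Algebra.Fundamental_Theorem_Algebra"
begin

text \<open>
  The map \<open>(u, v) \<mapsto> (u\<^sup>2, v\<^sup>2, uv)\<close> identifies \<open>M\<close> with the quotient of the plane by \<open>\<plusminus>1\<close>, and the
  time-\<open>t\<close> maps of \<open>\<Theta>\<close>, \<open>\<Xi>\<close> and \<open>x \<Xi>\<close> are induced by the shears \<open>(u + tv, v)\<close>, \<open>(u, v + tu)\<close> and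
  \<open>(u, v + tu\<^sup>3)\<close>. So everything is about the group generated by these shears, and transitivity on
  \<open>m\<close> points is proved by induction on \<open>m\<close>.

  Let \<open>L\<close> be the curve \<open>x = 0\<close> in the regular locus. The flow of \<open>\<Xi>\<close> fixes \<open>L\<close> pointwise and acts
  transitively on every curve \<open>x = c\<close> with \<open>c \<noteq> 0\<close>. For an element \<open>F\<close> of the group, call
  \<open>S = {p \<in> L. F p \<in> L}\<close> its section. Both the flow of \<open>\<Xi>\<close> and its conjugate by \<open>F\<close> fix \<open>S\<close>
  pointwise. If \<open>F\<close> is a suitable word in the shears, then every level curve of \<open>x\<close> meets every level
  curve of \<open>x \<circ> F\<close>, whence the pointwise stabiliser of \<open>S\<close> is transitive on the complement of \<open>S\<close>
  (lemma \<open>linked_off_translate_section\<close>).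

  Suppose now that the group is \<open>n\<close>-transitive, and let \<open>P\<close> be a set of \<open>n\<close> points of a finite
  section \<open>S\<close>. To make the stabiliser of \<open>P\<close> transitive off \<open>P\<close>, it suffices to move each point \<open>q\<close>
  of \<open>S - P\<close> out of \<open>S\<close> while fixing \<open>P\<close>. A conjugate of the flow of \<open>\<Xi>\<close> does this unless \<open>q\<close> lies
  in the hull of \<open>P\<close>, the intersection of all translates of \<open>L\<close> that contain \<open>P\<close>. So the hull of \<open>P\<close>
  has to be \<open>P\<close> itself, and this is a counting argument (lemma \<open>translate_hull_trivial\<close>). By
  \<open>n\<close>-transitivity all hulls of \<open>n\<close>-sets have the same size \<open>k\<close>, and on a section with \<open>N \<ge> n\<close>
  points they form a Steiner system: any \<open>n\<close> points lie in exactly one block. The blocks through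
  \<open>n - 1\<close> fixed points partition the other points, so \<open>k - n + 1\<close> divides \<open>N - n + 1\<close>. There are
  arbitrarily large sections with \<open>N\<close> and with \<open>N + 1\<close> points, which forces \<open>k = n\<close>.

  These two sections come from words that differ only in the last shear \<open>(u, v + su + tu\<^sup>3)\<close>
  (lemma \<open>ex_section_roots_consecutive\<close>). The points of the section are the nonzero roots \<open>y\<close> of a
  polynomial \<open>s b - a + t y b\<^sup>3\<close> with \<open>a(0) = 0 \<noteq> b(0)\<close>. For generic \<open>t\<close> all roots are simple, and
  whether \<open>0\<close> is one of them depends on \<open>s\<close> alone.
\<close>

section \<open>Preliminaries on group actions\<close>

lemma (in group_action) act_inv:
  assumes "g \<in> carrier G" "p \<in> E"
  shows "\<phi> (inv g) (\<phi> g p) = p" "\<phi> g (\<phi> (inv g) p) = p"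
proof -
  interpret group G using group_hom group_hom.axioms(1) by auto
  show "\<phi> (inv g) (\<phi> g p) = p" using assms orbit_sym_aux by blast
  show "\<phi> g (\<phi> (inv g) p) = p"
    using assms orbit_sym_aux[of "inv g" p] by auto
qed

lemma (in group_action) inv_carrier: "g \<in> carrier G \<Longrightarrow> inv g \<in> carrier G"
  using group_hom group_hom.axioms(1) group.inv_closed by fastforce

lemma (in group_action) mult_carrier: "g \<in> carrier G \<Longrightarrow> h \<in> carrier G \<Longrightarrow> g \<otimes> h \<in> carrier G"
  using group_hom group_hom.axioms(1) group.is_monoid monoid.m_closed by fastforce

lemma (in group_action) one_act: "\<one> \<in> carrier G" "p \<in> E \<Longrightarrow> \<phi> \<one> p = p"
  using group_hom group_hom.axioms(1) group.is_monoid monoid.one_closed id_eq_one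
  by (fastforce, metis restrict_apply')

section \<open>Hulls with respect to translates of a set\<close>

text \<open>The hull of \<open>P\<close> is the intersection of all the translates of \<open>L\<close> that contain \<open>P\<close>. It is
  phrased with \<open>\<phi> g ` P \<subseteq> L\<close> instead of \<open>P \<subseteq> \<phi> h ` L\<close>, which saves the passage to inverses.\<close>

definition (in group_action) translate_hull :: "'c set \<Rightarrow> 'c set \<Rightarrow> 'c set" where
  "translate_hull L P = {q \<in> E. \<forall>g\<in>carrier G. \<phi> g ` P \<subseteq> L \<longrightarrow> \<phi> g q \<in> L}"

text \<open>The intersection of \<open>L\<close> with its translate by the inverse of \<open>g\<close>.\<close>

definition (in group_action) translate_section :: "'c set \<Rightarrow> 'a \<Rightarrow> 'c set" where
  "translate_section L g = {p \<in> L. \<phi> g p \<in> L}"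

lemma (in group_action) subset_translate_hull: "P \<subseteq> E \<Longrightarrow> P \<subseteq> translate_hull L P"
  by (auto simp: translate_hull_def)

lemma (in group_action) translate_hull_least:
  "P \<subseteq> translate_hull L Q \<Longrightarrow> translate_hull L P \<subseteq> translate_hull L Q"
  unfolding translate_hull_def by blast

lemma (in group_action) translate_hull_image:
  assumes g: "g \<in> carrier G" and P: "P \<subseteq> E"
  shows "translate_hull L (\<phi> g ` P) = \<phi> g ` translate_hull L P"
proof -
  have sub: "\<phi> g ` translate_hull L P \<subseteq> translate_hull L (\<phi> g ` P)"
    if g: "g \<in> carrier G" and P: "P \<subseteq> E" for g P
  proof (rule image_subsetI)
    fix q assume q: "q \<in> translate_hull L P"
    then have qE: "q \<in> E" by (simp add: translate_hull_def)
    have "\<phi> h (\<phi> g q) \<in> L" if h: "h \<in> carrier G" and hP: "\<phi> h ` \<phi> g ` P \<subseteq> L" for h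
    proof -
      have "\<phi> (h \<otimes> g) ` P \<subseteq> L"
        using hP composition_rule[OF _ h g] P by fastforce
      then have "\<phi> (h \<otimes> g) q \<in> L"
        using q mult_carrier[OF h g] by (auto simp: translate_hull_def)
      then show ?thesis by (simp add: composition_rule[OF qE h g])
    qed
    then show "\<phi> g q \<in> translate_hull L (\<phi> g ` P)"
      using element_image[OF g qE] by (auto simp: translate_hull_def)
  qed
  have E: "\<phi> g ` P \<subseteq> E" using P surj_prop[OF g] by blast
  have "\<phi> (inv g) ` translate_hull L (\<phi> g ` P) \<subseteq> translate_hull L (\<phi> (inv g) ` \<phi> g ` P)"
    by (rule sub[OF inv_carrier[OF g] E])
  also have "\<phi> (inv g) ` \<phi> g ` P = P"
    using act_inv(1)[OF g] P by (force simp: image_image)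
  finally have "\<phi> g ` \<phi> (inv g) ` translate_hull L (\<phi> g ` P) \<subseteq> \<phi> g ` translate_hull L P"
    by blast
  moreover have "\<phi> g ` \<phi> (inv g) ` translate_hull L (\<phi> g ` P) = translate_hull L (\<phi> g ` P)"
    using act_inv(2)[OF g] by (force simp: image_image translate_hull_def)
  ultimately show ?thesis using sub[OF g P] by blast
qed

text \<open>A section is an intersection of two translates of \<open>L\<close>, and therefore contains the hulls of its
  subsets. This makes hulls finite as soon as finite sections exist.\<close>

lemma (in group_action) translate_hull_subset_section:
  assumes "L \<subseteq> E" "g \<in> carrier G" "P \<subseteq> translate_section L g"
  shows "translate_hull L P \<subseteq> translate_section L g"
proof -
  have "\<phi> \<one> ` P \<subseteq> L" "\<phi> g ` P \<subseteq> L" using assms one_act(2) unfolding translate_section_def by force+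
  then have "\<phi> \<one> q \<in> L \<and> \<phi> g q \<in> L \<and> q \<in> E" if "q \<in> translate_hull L P" for q
    using that assms(2) one_act(1) by (auto simp: translate_hull_def)
  then show ?thesis using one_act(2) unfolding translate_section_def by fastforce
qed

text \<open>The counting step for a Steiner system, with \<open>C q\<close> the block spanned by \<open>q\<close> and the fixed points
  \<open>B\<close>: outside \<open>B\<close> the blocks through \<open>B\<close> are pairwise disjoint and equally large.\<close>

lemma block_size_dvd:
  assumes T: "finite T" and B: "B \<subseteq> T"
    and C: "\<And>q. q \<in> T - B \<Longrightarrow> insert q B \<subseteq> C q \<and> C q \<subseteq> T \<and> card (C q) = k"
    and same: "\<And>q r. q \<in> T - B \<Longrightarrow> r \<in> C q - B \<Longrightarrow> C r = C q"
  shows "(k - card B) dvd (card T - card B)"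
proof -
  let ?F = "(\<lambda>q. C q - B) ` (T - B)"
  have U: "\<Union>?F = T - B" using C by blast
  have "(k - card B) * card ?F = card (\<Union>?F)"
  proof (rule card_partition)
    show "finite ?F" "finite (\<Union>?F)" using T U by auto
    show "card c = k - card B" if "c \<in> ?F" for c
      using that C B finite_subset[OF _ T] by (auto simp: card_Diff_subset)
    show "c \<inter> d = {}" if cd: "c \<in> ?F" "d \<in> ?F" "c \<noteq> d" for c d
    proof (rule ccontr)
      obtain q r where qr: "q \<in> T - B" "c = C q - B" "r \<in> T - B" "d = C r - B"
        using cd by auto
      assume "c \<inter> d \<noteq> {}"
      then obtain x where "x \<in> C q - B" "x \<in> C r - B" using qr by auto
      then have "C q = C r" using same[OF qr(1)] same[OF qr(3)] by metis
      then show False using qr cd by simp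
    qed
  qed
  then show ?thesis
    using U B T by (metis card_Diff_subset dvd_triv_left finite_subset)
qed

lemma multiply_transitive_sets:
  assumes "multiply_transitive n G E \<phi>"
    and P: "P \<subseteq> E" "finite P" "card P = n" and Q: "Q \<subseteq> E" "finite Q" "card Q = n"
  shows "\<exists>g\<in>carrier G. \<phi> g ` P = Q"
proof -
  obtain p where p: "bij_betw p {1..n} P"
    using ex_bij_betw_nat_finite_1[OF P(2)] P(3) by auto
  obtain q where q: "bij_betw q {1..n} Q"
    using ex_bij_betw_nat_finite_1[OF Q(2)] Q(3) by auto
  have "p \<in> {1..n} \<rightarrow> E \<and> inj_on p {1..n} \<and> q \<in> {1..n} \<rightarrow> E \<and> inj_on q {1..n}"
    using p q P(1) Q(1) by (auto simp: bij_betw_def)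
  then obtain g where g: "g \<in> carrier G" "\<forall>j\<in>{1..n}. \<phi> g (p j) = q j"
    using assms(1) unfolding multiply_transitive_def by blast
  have "\<phi> g ` P = \<phi> g ` p ` {1..n}" using p by (simp add: bij_betw_def)
  also have "\<dots> = q ` {1..n}" using g(2) by (auto simp: image_image)
  finally show ?thesis using q g(1) by (auto simp: bij_betw_def)
qed

text \<open>By \<open>n\<close>-transitivity the hull of an \<open>n\<close>-set has a size \<open>k\<close> that does not depend on the set, and it
  is finite because some \<open>n\<close>-set lies in a finite section. An \<open>n\<close>-subset of a hull therefore spans
  the same hull, so hulls are the blocks of a Steiner system on each large enough section. Two
  sections with consecutive sizes leave no room for \<open>k > n\<close>.\<close>

lemma (in group_action) translate_hull_trivial:
  assumes L: "L \<subseteq> E" and n: "0 < n" and trans: "multiply_transitive n G E \<phi>"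
    and g: "g \<in> carrier G" and S: "finite (translate_section L g)" "n \<le> card (translate_section L g)"
    and h: "h \<in> carrier G" and S': "Suc (card (translate_section L g)) = card (translate_section L h)"
    and P: "P \<subseteq> E" "finite P" "card P = n"
  shows "translate_hull L P = P"
proof -
  let ?S = "translate_section L"
  have SE: "?S g \<subseteq> E" for g using L by (auto simp: translate_section_def)
  obtain P0 where P0: "P0 \<subseteq> ?S g" "card P0 = n" "finite P0"
    using S(2) by (meson obtain_subset_with_card_n)
  define k where "k = card (translate_hull L P0)"
  have hull0: "finite (translate_hull L P0)"
    using translate_hull_subset_section[OF L g P0(1)] S(1) finite_subset by blast
  have blocks: "finite (translate_hull L Q) \<and> card (translate_hull L Q) = k"
    if Q: "Q \<subseteq> E" "finite Q" "card Q = n" for Q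
  proof -
    obtain f where f: "f \<in> carrier G" "\<phi> f ` P0 = Q"
      using multiply_transitive_sets[OF trans _ P0(3,2) Q] P0(1) SE by blast
    then have eq: "translate_hull L Q = \<phi> f ` translate_hull L P0"
      using translate_hull_image[OF f(1), of P0 L] P0(1) SE by blast
    moreover have "inj_on (\<phi> f) (translate_hull L P0)"
      by (rule inj_on_subset[OF inj_prop[OF f(1)]]) (auto simp: translate_hull_def)
    ultimately show ?thesis using hull0 by (simp add: card_image k_def)
  qed
  \<comment> \<open>Fix \<open>n - 1\<close> points \<open>B\<close> of the section and sort the other points by the block that they span with \<open>B\<close>.\<close>
  have dvd: "(k - (n - 1)) dvd (card (?S f) - (n - 1))"
    if f: "f \<in> carrier G" "finite (?S f)" "n \<le> card (?S f)" for f
  proof -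
    obtain B where B: "B \<subseteq> ?S f" "card B = n - 1" "finite B"
      using f(3) by (metis (no_types, lifting) diff_le_self le_trans obtain_subset_with_card_n)
    have ins: "insert q B \<subseteq> ?S f" "card (insert q B) = n" if "q \<in> ?S f - B" for q
      using that B n by auto
    have "(k - card B) dvd (card (?S f) - card B)"
    proof (rule block_size_dvd[of _ B "\<lambda>q. translate_hull L (insert q B)"])
      fix q assume q: "q \<in> ?S f - B"
      show "insert q B \<subseteq> translate_hull L (insert q B) \<and>
          translate_hull L (insert q B) \<subseteq> ?S f \<and> card (translate_hull L (insert q B)) = k"
        using subset_translate_hull[of "insert q B" L] blocks[of "insert q B"]
          translate_hull_subset_section[OF L f(1) ins(1)[OF q]] ins[OF q] SE[of f] B(3)
        by (meson finite_insert subset_trans)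
      fix r assume r: "r \<in> translate_hull L (insert q B) - B"
      have rS: "r \<in> ?S f - B"
        using r translate_hull_subset_section[OF L f(1) ins(1)[OF q]] by blast
      show "translate_hull L (insert r B) = translate_hull L (insert q B)"
      proof (rule card_subset_eq)
        have "B \<subseteq> translate_hull L (insert q B)"
          using subset_translate_hull[of "insert q B" L] ins(1)[OF q] SE[of f] by blast
        then show "translate_hull L (insert r B) \<subseteq> translate_hull L (insert q B)"
          using r by (intro translate_hull_least) auto
        have "insert q B \<subseteq> E" "insert r B \<subseteq> E"
          using ins(1)[OF q] ins(1)[OF rS] SE[of f] by blast+
        then show "finite (translate_hull L (insert q B))"
          "card (translate_hull L (insert r B)) = card (translate_hull L (insert q B))"
          using blocks[of "insert q B"] blocks[of "insert r B"] ins(2)[OF q] ins(2)[OF rS] B(3)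
          by auto
      qed
    qed (use f B in auto)
    then show ?thesis using B by simp
  qed
  have "finite (?S h)" using S' card_ge_0_finite[of "?S h"] by linarith
  then have "(k - (n - 1)) dvd (card (?S h) - (n - 1)) - (card (?S g) - (n - 1))"
    using S S' by (intro dvd_diff_nat[OF dvd[OF h] dvd[OF g]]) linarith+
  also have "(card (?S h) - (n - 1)) - (card (?S g) - (n - 1)) = 1"
    using S(2) S' n by linarith
  finally have "k = n" using n by auto
  then show ?thesis
    using blocks[OF P] card_subset_eq[OF _ subset_translate_hull[OF P(1)], of L] P(3) by simp
qed

section \<open>From pointwise stabilisers to infinite transitivity\<close>

definition (in group_action) linked :: "'c set \<Rightarrow> 'c \<Rightarrow> 'c \<Rightarrow> bool" where
  "linked S q r \<longleftrightarrow> (\<exists>f\<in>carrier G. (\<forall>p\<in>S. \<phi> f p = p) \<and> \<phi> f q = r)"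

lemma (in group_action) linkedI:
  "f \<in> carrier G \<Longrightarrow> (\<And>p. p \<in> S \<Longrightarrow> \<phi> f p = p) \<Longrightarrow> \<phi> f q = r \<Longrightarrow> linked S q r"
  by (auto simp: linked_def)

lemma (in group_action) linked_mono: "linked S q r \<Longrightarrow> P \<subseteq> S \<Longrightarrow> linked P q r"
  unfolding linked_def by blast

lemma (in group_action) linked_sym:
  assumes "linked S q r" "S \<subseteq> E" "q \<in> E"
  shows "linked S r q"
proof -
  obtain f where f: "f \<in> carrier G" "\<forall>p\<in>S. \<phi> f p = p" "\<phi> f q = r"
    using assms(1) by (auto simp: linked_def)
  show ?thesis
  proof (rule linkedI[OF inv_carrier[OF f(1)]])
    show "\<phi> (inv f) p = p" if "p \<in> S" for p
      using act_inv(1)[OF f(1), of p] f(2) that assms(2) by auto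
    show "\<phi> (inv f) r = q" using act_inv(1)[OF f(1) assms(3)] f(3) by simp
  qed
qed

lemma (in group_action) linked_trans:
  assumes "linked S p q" "linked S q r" "S \<subseteq> E" "p \<in> E"
  shows "linked S p r"
proof -
  obtain f where f: "f \<in> carrier G" "\<forall>p\<in>S. \<phi> f p = p" "\<phi> f p = q"
    using assms(1) by (auto simp: linked_def)
  obtain h where h: "h \<in> carrier G" "\<forall>p\<in>S. \<phi> h p = p" "\<phi> h q = r"
    using assms(2) by (auto simp: linked_def)
  show ?thesis
  proof (rule linkedI[OF mult_carrier[OF h(1) f(1)]])
    show "\<phi> (h \<otimes> f) x = x" if "x \<in> S" for x
      using composition_rule[OF _ h(1) f(1), of x] f(2) h(2) that assms(3) by auto
    show "\<phi> (h \<otimes> f) p = r" using composition_rule[OF assms(4) h(1) f(1)] f(3) h(3) by simp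
  qed
qed

text \<open>Conjugation by \<open>a\<close> carries the pointwise stabiliser of \<open>S\<close> to that of its image.\<close>

lemma (in group_action) linked_translate:
  assumes a: "a \<in> carrier G" and "linked (\<phi> a ` S) (\<phi> a q) (\<phi> a r)"
    and S: "S \<subseteq> E" and q: "q \<in> E" and r: "r \<in> E"
  shows "linked S q r"
proof -
  obtain f where f: "f \<in> carrier G" "\<forall>p\<in>S. \<phi> f (\<phi> a p) = \<phi> a p" "\<phi> f (\<phi> a q) = \<phi> a r"
    using assms(2) by (auto simp: linked_def)
  have fa: "\<phi> (inv a \<otimes> (f \<otimes> a)) p = \<phi> (inv a) (\<phi> f (\<phi> a p))" if "p \<in> E" for p
    using that a f(1) by (simp add: composition_rule mult_carrier inv_carrier)
  show ?thesis
  proof (rule linkedI)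
    show "inv a \<otimes> (f \<otimes> a) \<in> carrier G" using a f(1) by (simp add: mult_carrier inv_carrier)
    show "\<phi> (inv a \<otimes> (f \<otimes> a)) p = p" if "p \<in> S" for p
      using fa[of p] act_inv(1)[OF a, of p] f(2) that S by auto
    show "\<phi> (inv a \<otimes> (f \<otimes> a)) q = r" using fa[OF q] act_inv(1)[OF a r] f(3) by simp
  qed
qed

text \<open>With \<open>n\<close>-transitivity it is enough to know the stabiliser of a single \<open>n\<close>-set: both
  configurations are first brought to the position where their first \<open>n\<close> points enumerate \<open>P\<close>.\<close>

lemma (in group_action) multiply_transitive_Suc:
  assumes trans: "multiply_transitive n G E \<phi>"
    and P: "P \<subseteq> E" "finite P" "card P = n"
    and link: "\<And>q r. q \<in> E - P \<Longrightarrow> r \<in> E - P \<Longrightarrow> linked P q r"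
  shows "multiply_transitive (Suc n) G E \<phi>"
proof -
  obtain e where e: "bij_betw e {1..n} P"
    using ex_bij_betw_nat_finite_1[OF P(2)] P(3) by auto
  have reduce: "\<exists>a\<in>carrier G. (\<forall>j\<in>{1..n}. \<phi> a (p j) = e j) \<and> \<phi> a (p (Suc n)) \<in> E - P"
    if p: "p \<in> {1..Suc n} \<rightarrow> E" "inj_on p {1..Suc n}" for p
  proof -
    have "p \<in> {1..n} \<rightarrow> E \<and> inj_on p {1..n} \<and> e \<in> {1..n} \<rightarrow> E \<and> inj_on e {1..n}"
      using p e P(1) inj_on_subset[OF p(2), of "{1..n}"] by (auto simp: bij_betw_def)
    then obtain a where a: "a \<in> carrier G" "\<forall>j\<in>{1..n}. \<phi> a (p j) = e j"
      using trans[unfolded multiply_transitive_def, rule_format, of p e] by blast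
    have pE: "p (Suc n) \<in> E" using p(1) by auto
    have "\<phi> a (p (Suc n)) \<notin> P"
    proof
      assume "\<phi> a (p (Suc n)) \<in> P"
      then obtain j where j: "j \<in> {1..n}" "\<phi> a (p (Suc n)) = \<phi> a (p j)"
        using a(2) e by (auto simp: bij_betw_def)
      moreover have "p j \<in> E" using p(1) j(1) by auto
      ultimately have "p (Suc n) = p j" using inj_prop[OF a(1)] pE by (auto dest: inj_onD)
      then have "Suc n = j" using p(2) j(1) by (auto dest!: inj_onD)
      then show False using j(1) by simp
    qed
    then show ?thesis using a element_image[OF a(1) pE] by blast
  qed
  show ?thesis unfolding multiply_transitive_def
  proof (intro allI impI)
    fix p q
    assume "p \<in> {1..Suc n} \<rightarrow> E \<and> inj_on p {1..Suc n} \<and> q \<in> {1..Suc n} \<rightarrow> E \<and> inj_on q {1..Suc n}"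
    then have p: "p \<in> {1..Suc n} \<rightarrow> E" "inj_on p {1..Suc n}"
      and q: "q \<in> {1..Suc n} \<rightarrow> E" "inj_on q {1..Suc n}" by auto
    obtain a where a: "a \<in> carrier G" "\<forall>j\<in>{1..n}. \<phi> a (p j) = e j" "\<phi> a (p (Suc n)) \<in> E - P"
      using reduce[OF p] by blast
    obtain b where b: "b \<in> carrier G" "\<forall>j\<in>{1..n}. \<phi> b (q j) = e j" "\<phi> b (q (Suc n)) \<in> E - P"
      using reduce[OF q] by blast
    obtain c where c: "c \<in> carrier G" "\<forall>x\<in>P. \<phi> c x = x"
        "\<phi> c (\<phi> a (p (Suc n))) = \<phi> b (q (Suc n))"
      using link[OF a(3) b(3)] by (auto simp: linked_def)
    define f where "f = inv b \<otimes> (c \<otimes> a)"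
    have fG: "f \<in> carrier G" using a(1) b(1) c(1)
      by (auto simp: f_def intro!: mult_carrier inv_carrier)
    have "\<phi> f (p j) = q j" if j: "j \<in> {1..Suc n}" for j
    proof -
      have E: "p j \<in> E" "q j \<in> E" using p(1) q(1) j by auto
      have "\<phi> c (\<phi> a (p j)) = \<phi> b (q j)"
      proof (cases "j = Suc n")
        case True
        then show ?thesis using c(3) by simp
      next
        case False
        then have "j \<in> {1..n}" using j by auto
        then show ?thesis using a(2) b(2) c(2) e by (auto simp: bij_betw_def)
      qed
      then have "\<phi> f (p j) = \<phi> (inv b) (\<phi> b (q j))"
        unfolding f_def using E a(1) b(1) c(1)
        by (simp add: composition_rule mult_carrier inv_carrier)
      then show ?thesis using act_inv(1)[OF b(1)] E by simp
    qed
    then show "\<exists>g\<in>carrier G. \<forall>j\<in>{1..Suc n}. \<phi> g (p j) = q j" using fG by blast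
  qed
qed

text \<open>Here \<open>K\<close> plays the role of a one-parameter group that fixes \<open>L\<close> pointwise. A point outside the
  hull of \<open>P\<close> is taken off \<open>L\<close> by some group element that keeps \<open>P\<close> inside \<open>L\<close>; conjugating \<open>K\<close> by
  this element yields infinitely many images of the point under the stabiliser of \<open>P\<close>, which cannot
  all lie in a finite section. The hypothesis \<open>leave\<close> does the work of the trivial hull when \<open>P\<close>
  is empty, where the counting argument does not apply.\<close>

lemma (in group_action) infinitely_transitive_if_sections:
  assumes L: "L \<subseteq> E"
    and K: "K \<subseteq> carrier G" "\<And>k p. k \<in> K \<Longrightarrow> p \<in> L \<Longrightarrow> \<phi> k p = p"
      "\<And>q. q \<in> E - L \<Longrightarrow> infinite {\<phi> k q | k. k \<in> K}"
    and leave: "\<And>q. q \<in> E \<Longrightarrow> \<exists>g\<in>carrier G. \<phi> g q \<notin> L"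
    and sections: "\<And>n. \<exists>g\<in>carrier G. \<exists>h\<in>carrier G.
        finite (translate_section L g) \<and> n \<le> card (translate_section L g) \<and>
        card (translate_section L h) = Suc (card (translate_section L g)) \<and>
        (\<forall>q\<in>E - translate_section L g. \<forall>r\<in>E - translate_section L g.
          linked (translate_section L g) q r)"
  shows "infinitely_transitive_action G E \<phi>"
proof -
  have "multiply_transitive n G E \<phi>" for n
  proof (induction n)
    case 0
    show ?case using one_act(1) by (auto simp: multiply_transitive_def)
  next
    case (Suc n)
    obtain g h where g: "g \<in> carrier G" and h: "h \<in> carrier G" and
      S: "finite (translate_section L g)" "n \<le> card (translate_section L g)"
        "card (translate_section L h) = Suc (card (translate_section L g))" and
      link: "\<forall>q\<in>E - translate_section L g. \<forall>r\<in>E - translate_section L g.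
          linked (translate_section L g) q r"
      using sections[of n] by (elim bexE conjE)
    let ?S = "translate_section L g"
    obtain P where PS: "P \<subseteq> ?S" "card P = n" "finite P"
      using S(2) by (meson obtain_subset_with_card_n)
    have P: "P \<subseteq> E" using PS(1) L by (auto simp: translate_section_def)
    have escape: "\<exists>q'\<in>E - ?S. linked P q q'" if q: "q \<in> E - P" for q
    proof -
      obtain a where a: "a \<in> carrier G" "\<phi> a ` P \<subseteq> L" "\<phi> a q \<notin> L"
      proof (cases "n = 0")
        case True
        then show ?thesis using leave[of q] q that PS by auto
      next
        case False
        then have "q \<notin> translate_hull L P"
          using translate_hull_trivial[OF L _ Suc.IH g S(1,2) h S(3)[symmetric] P] q PS by auto
        then show ?thesis using q that by (auto simp: translate_hull_def)
      qed
      have aq: "\<phi> a q \<in> E" using element_image[OF a(1)] q by blast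
      have "infinite {\<phi> k (\<phi> a q) | k. k \<in> K}" using K(3) a(3) aq by blast
      moreover have "finite (\<phi> a ` ?S)" using S(1) by blast
      ultimately obtain k where k: "k \<in> K" "\<phi> k (\<phi> a q) \<notin> \<phi> a ` ?S"
        by (smt (verit) finite_subset mem_Collect_eq subsetI)
      have kG: "k \<in> carrier G" using k K(1) by blast
      define q' where "q' = \<phi> (inv a) (\<phi> k (\<phi> a q))"
      have kaq: "\<phi> k (\<phi> a q) \<in> E" using element_image[OF kG aq] by blast
      then have q'E: "q' \<in> E"
        unfolding q'_def using element_image[OF inv_carrier[OF a(1)]] by blast
      have aq': "\<phi> a q' = \<phi> k (\<phi> a q)" unfolding q'_def using act_inv(2)[OF a(1) kaq] .
      have "linked (\<phi> a ` P) (\<phi> a q) (\<phi> a q')"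
        using K(2)[OF k(1)] a(2) aq' by (intro linkedI[OF kG]) auto
      then have "linked P q q'" using linked_translate[OF a(1)] P q q'E by blast
      moreover have "q' \<notin> ?S" using k(2) aq' by force
      ultimately show ?thesis using q'E by blast
    qed
    have "linked P q r" if q: "q \<in> E - P" and r: "r \<in> E - P" for q r
    proof -
      obtain q' where q': "q' \<in> E - ?S" "linked P q q'" using escape[OF q] by blast
      obtain r' where r': "r' \<in> E - ?S" "linked P r r'" using escape[OF r] by blast
      have "linked P q' r'" using link q'(1) r'(1) linked_mono[OF _ PS(1)] by blast
      then show ?thesis
        using q' r' q r P by (meson DiffD1 linked_sym linked_trans)
    qed
    then show ?case using multiply_transitive_Suc[OF Suc.IH P PS(3,2)] by blast
  qed
  then show ?thesis
    by (simp add: infinitely_transitive_action_def group_action_axioms)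
qed

section \<open>Roots of generic members of a pencil of polynomials\<close>

lemma card_roots_rsquarefree:
  fixes p :: "complex poly"
  assumes "rsquarefree p"
  shows "finite {z. poly p z = 0}" "card {z. poly p z = 0} = degree p"
proof -
  have p0: "p \<noteq> 0" using assms by (simp add: rsquarefree_def)
  show "finite {z. poly p z = 0}" using poly_roots_finite[OF p0] .
  have "degree p = degree (smult (lead_coeff p) (\<Prod>z | poly p z = 0. [:-z, 1:]))"
    using complex_poly_decompose_rsquarefree[OF assms] by simp
  also have "\<dots> = degree (\<Prod>z | poly p z = 0. [:-z, 1:])" using p0 by simp
  also have "\<dots> = (\<Sum>z | poly p z = 0. degree [:-z, 1:])"
    by (rule degree_prod_eq_sum_degree) auto
  finally show "card {z. poly p z = 0} = degree p" by simp
qed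

text \<open>A double root of \<open>p + tq\<close> is a critical point of the rational function \<open>p/q\<close> with value \<open>-t\<close>.
  The critical points are the roots of the Wronskian \<open>p'q - pq'\<close>, so only finitely many \<open>t\<close> are
  bad once the Wronskian is known to be nonzero.\<close>

lemma generic_pencil_member_rsquarefree:
  fixes p q :: "complex poly"
  assumes coprime: "\<And>z. poly q z = 0 \<Longrightarrow> poly p z \<noteq> 0" and deg: "degree p < degree q"
  shows "finite {t. t = 0 \<or> \<not> rsquarefree (p + smult t q) \<or> degree (p + smult t q) \<noteq> degree q}"
proof -
  define d where "d = pderiv p * q - p * pderiv q"
  obtain z where z: "poly q z = 0"
    using fundamental_theorem_of_algebra[of q] deg by (auto simp: constant_degree)
  have p0: "p \<noteq> 0" using coprime[OF z] by auto
  have q'0: "pderiv q \<noteq> 0" using deg by (auto simp: pderiv_eq_0_iff)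
  have q0: "q \<noteq> 0" using deg by auto
  \<comment> \<open>At a root \<open>z\<close> of \<open>q\<close> the two terms of the Wronskian vanish to different orders.\<close>
  have "d \<noteq> 0"
  proof
    assume "d = 0"
    then have eq: "pderiv p * q = p * pderiv q" by (simp add: d_def)
    then have nz: "pderiv p * q \<noteq> 0" using p0 q'0 by simp
    have "Polynomial.order z q \<noteq> 0" using z q0 by (simp add: order_root)
    then have "Polynomial.order z (pderiv p * q) \<ge> Suc (Polynomial.order z (pderiv q))"
      using order_mult[OF nz] order_pderiv[OF q0 z] by simp
    moreover have "Polynomial.order z (p * pderiv q) = Polynomial.order z (pderiv q)"
      using order_mult[of p "pderiv q" z] p0 q'0 order_0I[OF coprime[OF z]] by simp
    ultimately show False using eq by simp
  qed
  have "t \<in> insert 0 ((\<lambda>y. - poly p y / poly q y) ` {y. poly d y = 0})"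
    if t: "t = 0 \<or> \<not> rsquarefree (p + smult t q) \<or> degree (p + smult t q) \<noteq> degree q" for t
  proof (cases "t = 0")
    case False
    then have "degree (p + smult t q) = degree q"
      using deg by (subst degree_add_eq_right) auto
    then obtain y where y: "poly p y + t * poly q y = 0"
        "poly (pderiv p) y + t * poly (pderiv q) y = 0"
      using t False by (auto simp: rsquarefree_roots pderiv_add pderiv_smult)
    have qy: "poly q y \<noteq> 0" using coprime[of y] y(1) by auto
    have "poly d y = poly q y * (poly (pderiv p) y + t * poly (pderiv q) y)
        - poly (pderiv q) y * (poly p y + t * poly q y)"
      by (simp add: d_def algebra_simps)
    then have "poly d y = 0" using y by simp
    moreover have "t = - poly p y / poly q y"
      using y(1) qy by (simp add: field_simps add_eq_0_iff)
    ultimately show ?thesis by blast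
  qed simp
  then have "{t. t = 0 \<or> \<not> rsquarefree (p + smult t q) \<or> degree (p + smult t q) \<noteq> degree q}
      \<subseteq> insert 0 ((\<lambda>y. - poly p y / poly q y) ` {y. poly d y = 0})" by blast
  then show ?thesis
    by (rule finite_subset) (simp add: poly_roots_finite[OF \<open>d \<noteq> 0\<close>])
qed

lemma degree_diff_eq_left:
  "degree q < degree p \<Longrightarrow> degree (p - q) = degree (p :: 'a::ab_group_add poly)"
  using degree_add_eq_left[of "- q" p] by simp

section \<open>Polynomials of words in the shears\<close>

text \<open>The map \<open>(u, v) \<mapsto> (v + u\<^sup>3, -u)\<close> sends \<open>(w\<^sub>k\<^sub>+\<^sub>1, -w\<^sub>k)\<close> to \<open>(w\<^sub>k\<^sub>+\<^sub>2, -w\<^sub>k\<^sub>+\<^sub>1)\<close>, where \<open>w\<^sub>k\<close>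
  stands for \<open>cubic_word u v k\<close>; so these are, up to sign, the coordinate functions of its iterates
  applied to the rotated point \<open>(v, -u)\<close>. The ring is left open in order to use the same recursion for numbers and for polynomials in \<open>v\<close>.\<close>

fun cubic_word :: "'a::comm_ring_1 \<Rightarrow> 'a \<Rightarrow> nat \<Rightarrow> 'a" where
  "cubic_word a b 0 = a"
| "cubic_word a b (Suc 0) = b"
| "cubic_word a b (Suc (Suc k)) = cubic_word a b (Suc k) ^ 3 - cubic_word a b k"

lemma poly_cubic_word: "poly (cubic_word p q k) v = cubic_word (poly p v) (poly q v) k"
  by (induction p q k rule: cubic_word.induct) auto

text \<open>As a polynomial in \<open>v\<close> the word \<open>k + 1\<close> has larger degree than the word \<open>k\<close>, so the cubic term
  dominates and the left-hand side is a nonconstant polynomial, whatever \<open>c\<close> is.\<close>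

lemma cubic_word_surj:
  fixes c d s t :: complex
  assumes t: "t \<noteq> 0"
  shows "\<exists>v. t * cubic_word c v (Suc k) ^ 3 + s * cubic_word c v (Suc k) - cubic_word c v k = d"
proof -
  let ?w = "cubic_word [:c:] [:0, 1:]"
  have deg: "degree (?w k) < degree (?w (Suc k))" for k
  proof (induction k)
    case (Suc k)
    have "degree (?w (Suc k) ^ 3) = 3 * degree (?w (Suc k))"
      using Suc by (subst degree_power_eq) auto
    then show ?case using Suc by (simp add: degree_diff_eq_left)
  qed simp
  define p where "p = smult t (?w (Suc k) ^ 3)"
  define q where "q = [:- d:] + (smult s (?w (Suc k)) - ?w k)"
  have "degree p = 3 * degree (?w (Suc k))"
    unfolding p_def using deg[of k] t by (subst degree_smult_eq, subst degree_power_eq) auto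
  moreover have "degree q \<le> degree (?w (Suc k))"
    unfolding q_def using deg[of k] by (intro degree_add_le degree_diff_le) auto
  ultimately have "degree (p + q) \<noteq> 0"
    using deg[of k] by (subst degree_add_eq_left) auto
  then obtain v where "poly (p + q) v = 0"
    using fundamental_theorem_of_algebra[of "p + q"] by (auto simp: constant_degree)
  then have "t * cubic_word c v (Suc k) ^ 3 + s * cubic_word c v (Suc k) - cubic_word c v k = d"
    by (simp add: p_def q_def poly_cubic_word del: cubic_word.simps) (simp add: algebra_simps del: cubic_word.simps)
  then show ?thesis ..
qed

text \<open>At \<open>u = 0\<close> the words are odd polynomials in \<open>v\<close>. With \<open>y = v\<^sup>2\<close>, the coordinate of \<open>M\<close> along
  \<open>x = 0\<close>, they have the form \<open>v b(y)\<close>, and the recursion for the factors \<open>b\<close> is the following one.\<close>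

fun odd_word_factor :: "nat \<Rightarrow> complex poly" where
  "odd_word_factor 0 = 0"
| "odd_word_factor (Suc 0) = 1"
| "odd_word_factor (Suc (Suc k)) = [:0, 1:] * odd_word_factor (Suc k) ^ 3 - odd_word_factor k"

lemma cubic_word_0: "cubic_word 0 v k = v * poly (odd_word_factor k) (v\<^sup>2)"
  by (induction k rule: odd_word_factor.induct)
    (auto simp: algebra_simps power2_eq_square power3_eq_cube)

lemma odd_word_factor_coprime:
  "\<not> (poly (odd_word_factor k) y = 0 \<and> poly (odd_word_factor (Suc k)) y = 0)"
  by (induction k) auto

lemma odd_word_factor_at_0:
  "poly (odd_word_factor (2 * i)) 0 = 0" "poly (odd_word_factor (Suc (2 * i))) 0 \<noteq> 0"
  by (induction i) auto

lemma degree_odd_word_factor: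
  "degree (odd_word_factor k) \<le> degree (odd_word_factor (Suc k)) \<and>
   k \<le> degree (odd_word_factor (Suc k)) \<and> odd_word_factor (Suc k) \<noteq> 0"
proof (induction k)
  case (Suc k)
  let ?b = "odd_word_factor"
  have "degree ([:0, 1:] * ?b (Suc k) ^ 3) = Suc (3 * degree (?b (Suc k)))"
    using Suc by (subst degree_mult_eq) (auto simp: degree_power_eq)
  then have "degree (?b (Suc (Suc k))) = Suc (3 * degree (?b (Suc k)))"
    using Suc by (simp add: degree_diff_eq_left)
  then show ?case using Suc by force
qed simp

text \<open>The root \<open>y = 0\<close> is left out because it corresponds to the singular point of \<open>M\<close>.\<close>

definition section_roots :: "nat \<Rightarrow> complex \<Rightarrow> complex \<Rightarrow> complex set" where
  "section_roots k s t = {y. y \<noteq> 0 \<and>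
     poly (smult s (odd_word_factor (Suc k)) - odd_word_factor k
       + smult t ([:0, 1:] * odd_word_factor (Suc k) ^ 3)) y = 0}"

text \<open>Write \<open>a\<close> and \<open>b\<close> for two consecutive factors, of even and odd index, so that \<open>a(0) = 0 \<noteq> b(0)\<close>.
  For \<open>s = 1\<close> and generic \<open>t\<close> the polynomial \<open>b - a + t y b\<^sup>3\<close> has \<open>3 deg b + 1\<close> roots, all simple and
  nonzero. For \<open>s = 0\<close> the polynomial \<open>- a + t y b\<^sup>3\<close> is divisible by \<open>y\<close>, and its quotient by \<open>y\<close> has
  \<open>3 deg b\<close> roots, again simple and nonzero for generic \<open>t\<close>.\<close>

lemma ex_section_roots_consecutive:
  "\<exists>k t t'. t \<noteq> 0 \<and> t' \<noteq> 0 \<and> finite (section_roots k 0 t) \<and> n \<le> card (section_roots k 0 t) \<and>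
     card (section_roots k 1 t') = Suc (card (section_roots k 0 t))"
proof -
  \<comment> \<open>Even, and large enough for the degree of \<open>b\<close> to exceed \<open>n\<close>.\<close>
  define k where "k = 2 * Suc n"
  define a where "a = odd_word_factor k"
  define b where "b = odd_word_factor (Suc k)"
  have b0: "poly b 0 \<noteq> 0" and a0: "poly a 0 = 0"
    using odd_word_factor_at_0[of "Suc n"] by (simp_all add: a_def b_def k_def)
  have ab: "poly a y \<noteq> 0" if "poly b y = 0" for y
    using odd_word_factor_coprime[of k y] that by (auto simp: a_def b_def)
  have deg: "degree a \<le> degree b" "n < degree b" "b \<noteq> 0"
    using degree_odd_word_factor[of k] by (auto simp: a_def b_def k_def)
  obtain c where c: "a = [:0, 1:] * c" using a0 by (auto simp: poly_eq_0_iff_dvd elim: dvdE)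
  have degb3: "degree (b ^ 3) = 3 * degree b" using deg by (simp add: degree_power_eq)
  have degb4: "degree ([:0, 1:] * b ^ 3) = Suc (3 * degree b)"
    using degb3 deg(3) by (subst degree_mult_eq) auto
  have degc: "degree c \<le> degree a" unfolding c by (cases "c = 0") (auto simp: degree_mult_eq)

  have "finite {t. t = 0 \<or> \<not> rsquarefree (- c + smult t (b ^ 3))
      \<or> degree (- c + smult t (b ^ 3)) \<noteq> degree (b ^ 3)}"
  proof (rule generic_pencil_member_rsquarefree)
    show "poly (- c) z \<noteq> 0" if "poly (b ^ 3) z = 0" for z
      using that ab[of z] by (auto simp: c)
    show "degree (- c) < degree (b ^ 3)" using degc deg degb3 by simp
  qed
  \<comment> \<open>One more value of \<open>t\<close> is excluded, the one for which the quotient by \<open>y\<close> still vanishes at \<open>0\<close>.\<close>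
  then have "finite ({t. t = 0 \<or> \<not> rsquarefree (- c + smult t (b ^ 3))
      \<or> degree (- c + smult t (b ^ 3)) \<noteq> degree (b ^ 3)} \<union> {poly c 0 / poly b 0 ^ 3})" by simp
  then obtain t where t: "t \<noteq> 0" "rsquarefree (- c + smult t (b ^ 3))"
      "degree (- c + smult t (b ^ 3)) = 3 * degree b" "t \<noteq> poly c 0 / poly b 0 ^ 3"
    using ex_new_if_finite[OF infinite_UNIV_char_0] degb3 by (smt (verit) UnCI mem_Collect_eq singletonI)
  have "poly (- c + smult t (b ^ 3)) 0 \<noteq> 0" using t(4) b0 by (auto simp: field_simps)
  then have "section_roots k 0 t = {y. poly (- c + smult t (b ^ 3)) y = 0}"
    unfolding section_roots_def a_def[symmetric] b_def[symmetric]
    by (auto simp: c algebra_simps)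
  then have S0: "finite (section_roots k 0 t)" "card (section_roots k 0 t) = 3 * degree b"
    using card_roots_rsquarefree[OF t(2)] t(3) by auto

  have "finite {t. t = 0 \<or> \<not> rsquarefree ((b - a) + smult t ([:0, 1:] * b ^ 3))
      \<or> degree ((b - a) + smult t ([:0, 1:] * b ^ 3)) \<noteq> degree ([:0, 1:] * b ^ 3)}"
  proof (rule generic_pencil_member_rsquarefree)
    show "poly (b - a) z \<noteq> 0" if "poly ([:0, 1:] * b ^ 3) z = 0" for z
      using that ab[of z] a0 b0 by auto
    show "degree (b - a) < degree ([:0, 1:] * b ^ 3)"
      using degb4 degree_diff_le[of b "degree b" a] deg by simp
  qed
  then obtain t' where t': "t' \<noteq> 0" "rsquarefree ((b - a) + smult t' ([:0, 1:] * b ^ 3))"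
      "degree ((b - a) + smult t' ([:0, 1:] * b ^ 3)) = Suc (3 * degree b)"
    using ex_new_if_finite[OF infinite_UNIV_char_0] degb4 by (smt (verit) mem_Collect_eq)
  have "section_roots k 1 t' = {y. poly ((b - a) + smult t' ([:0, 1:] * b ^ 3)) y = 0}"
    unfolding section_roots_def a_def[symmetric] b_def[symmetric]
    using a0 b0 by auto
  then have "card (section_roots k 1 t') = Suc (3 * degree b)"
    using card_roots_rsquarefree[OF t'(2)] t'(3) by auto
  then show ?thesis using S0 t(1) t'(1) deg by (intro exI[of _ k] exI[of _ t] exI[of _ t']) auto
qed

section \<open>Exponentials of locally nilpotent derivations\<close>

lemma derivation_sum:
  assumes D: "derivation D" and "finite A"
  shows "D (\<Sum>i\<in>A. f i) = (\<Sum>i\<in>A. D (f i))"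
  using assms(2) by (induction A rule: finite_induct)
    (simp_all add: derivation_add[OF D] derivation_zero[OF D])

lemma derivation_of_nat:
  assumes D: "derivation D"
  shows "D (of_nat n * f) = of_nat n * D f"
proof -
  have "D (of_nat n) = 0"
    by (induction n) (simp_all add: derivation_zero[OF D] derivation_add[OF D] derivation_one[OF D])
  then show ?thesis by (simp add: derivation_mult[OF D])
qed

lemma derivation_cconst: "derivation D \<Longrightarrow> D (cconst c) = 0"
  using derivation_one[of D] unfolding derivation_def by (metis mult.right_neutral mult_zero_right)

lemma derivation_pow_mult:
  assumes D: "derivation D"
  shows "(D ^^ n) (f * g) = (\<Sum>k\<le>n. of_nat (n choose k) * ((D ^^ k) f * (D ^^ (n - k)) g))"
proof (induction n)
  case (Suc n)
  define T where "T k = (D ^^ k) f * (D ^^ (Suc n - k)) g" for k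
  have "(D ^^ Suc n) (f * g) = D (\<Sum>k\<le>n. of_nat (n choose k) * ((D ^^ k) f * (D ^^ (n - k)) g))"
    using Suc by simp
  also have "\<dots> = (\<Sum>k\<le>n. of_nat (n choose k) * D ((D ^^ k) f * (D ^^ (n - k)) g))"
    by (simp add: derivation_sum[OF D] derivation_of_nat[OF D])
  also have "\<dots> = (\<Sum>k\<le>n. of_nat (n choose k) * (T k + T (Suc k)))"
    by (rule sum.cong) (auto simp: T_def derivation_mult[OF D] Suc_diff_le mult.commute)
  also have "\<dots> = (\<Sum>k\<le>n. of_nat (n choose k) * T (Suc k)) + (\<Sum>k\<le>Suc n. of_nat (n choose k) * T k)"
    by (simp add: distrib_left sum.distrib binomial_eq_0 add.commute)
  also have "(\<Sum>k\<le>Suc n. of_nat (n choose k) * T k)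
      = T 0 + (\<Sum>k\<le>n. of_nat (n choose Suc k) * T (Suc k))"
    by (subst sum.atMost_Suc_shift) simp
  also have "(\<Sum>k\<le>n. of_nat (n choose k) * T (Suc k)) +
      (T 0 + (\<Sum>k\<le>n. of_nat (n choose Suc k) * T (Suc k)))
      = T 0 + (\<Sum>k\<le>n. of_nat (Suc n choose Suc k) * T (Suc k))"
    by (simp add: distrib_right sum.distrib)
  also have "\<dots> = (\<Sum>k\<le>Suc n. of_nat (Suc n choose k) * T k)"
    using sum.atMost_Suc_shift[of "\<lambda>k. of_nat (Suc n choose k) * T k" n]
    by (simp del: binomial_Suc_Suc)
  finally show ?case by (simp only: T_def)
qed simp

lemma eval_sum: "p \<in> M \<Longrightarrow> eval (\<Sum>i\<in>A. f i) p = (\<Sum>i\<in>A. eval (f i) p)"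
  by (induction A rule: infinite_finite_induct) simp_all

lemma eval_of_nat: "p \<in> M \<Longrightarrow> eval (of_nat n) p = of_nat n"
  by (induction n) simp_all

text \<open>As a convergent series the exponential is open to the Cauchy product, without any bookkeeping of
  the lengths of the finite sums.\<close>

lemma eval_exp_derivation_sums:
  assumes D: "derivation D" "locally_nilpotent D" and p: "p \<in> M"
  shows "(\<lambda>n. t ^ n / fact n * eval ((D ^^ n) f) p) sums eval (exp_derivation t D f) p"
proof -
  have "(\<lambda>n. t ^ n / fact n * eval ((D ^^ n) f) p) sums
      (\<Sum>n | (D ^^ n) f \<noteq> 0. t ^ n / fact n * eval ((D ^^ n) f) p)"
    by (rule sums_finite[OF locally_nilpotent_finite[OF D]]) (simp add: p)
  then show ?thesis by (simp add: exp_derivation_def eval_sum p)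
qed

lemma eval_exp_derivation_eq_sum:
  assumes D: "derivation D" "locally_nilpotent D" and p: "p \<in> M" and N: "(D ^^ N) f = 0"
  shows "eval (exp_derivation t D f) p = (\<Sum>n<N. t ^ n / fact n * eval ((D ^^ n) f) p)"
proof (rule sums_unique2[OF eval_exp_derivation_sums[OF D p] sums_finite])
  show "t ^ n / fact n * eval ((D ^^ n) f) p = 0" if "n \<notin> {..<N}" for n
    using that derivation_pow_mono[OF D(1) N, of n] p by simp
qed simp

lemma eval_exp_derivation_mult:
  assumes D: "derivation D" "locally_nilpotent D" and p: "p \<in> M"
  shows "eval (exp_derivation t D (f * g)) p = eval (exp_derivation t D f) p * eval (exp_derivation t D g) p"
proof -
  define a where "a f n = t ^ n / fact n * eval ((D ^^ n) f) p" for f n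
  have sums: "a f sums eval (exp_derivation t D f) p" for f
    unfolding a_def by (rule eval_exp_derivation_sums[OF D p])
  have summable: "summable (\<lambda>n. norm (a f n))" for f
    by (rule summable_finite[OF locally_nilpotent_finite[OF D, of f]]) (auto simp: a_def p)
  have "a (f * g) n = (\<Sum>k\<le>n. a f k * a g (n - k))" for n
  proof -
    have "a (f * g) n = (\<Sum>k\<le>n. t ^ n / fact n *
        (of_nat (n choose k) * (eval ((D ^^ k) f) p * eval ((D ^^ (n - k)) g) p)))"
      by (simp add: a_def derivation_pow_mult[OF D(1)] eval_sum p eval_of_nat sum_distrib_left)
    also have "\<dots> = (\<Sum>k\<le>n. a f k * a g (n - k))"
    proof (rule sum.cong)
      fix k assume "k \<in> {..n}"
      then have "k \<le> n" by simp
      then have "t ^ n = t ^ k * t ^ (n - k)" "(of_nat (n choose k) :: complex) = fact n / (fact k * fact (n - k))"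
        by (simp_all add: binomial_fact flip: power_add)
      then show "t ^ n / fact n * (of_nat (n choose k) * (eval ((D ^^ k) f) p * eval ((D ^^ (n - k)) g) p))
          = a f k * a g (n - k)"
        by (simp add: a_def)
    qed simp
    finally show ?thesis .
  qed
  moreover have "(\<lambda>n. \<Sum>k\<le>n. a f k * a g (n - k)) sums (suminf (a f) * suminf (a g))"
    by (rule Cauchy_product_sums[OF summable summable])
  ultimately have "a (f * g) sums (suminf (a f) * suminf (a g))" by (simp cong: sums_cong)
  then show ?thesis using sums sums_unique sums_unique2 by metis
qed

lemma eval_exp_derivation_add:
  assumes D: "derivation D" "locally_nilpotent D" and p: "p \<in> M"
  shows "eval (exp_derivation t D (f + g)) p = eval (exp_derivation t D f) p + eval (exp_derivation t D g) p"
  using sums_add[OF eval_exp_derivation_sums[OF D p, of t f] eval_exp_derivation_sums[OF D p, of t g]]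
    eval_exp_derivation_sums[OF D p, of t "f + g"]
  by (simp add: derivation_pow_add[OF D(1)] p distrib_left add_divide_distrib sums_unique2)

text \<open>Both sides are ring homomorphisms in \<open>f\<close>, so a time-\<open>t\<close> map is determined by the three coordinate
  functions.\<close>

lemma eval_exp_derivation:
  assumes D: "derivation D" "locally_nilpotent D" and p: "p \<in> M" and q: "q \<in> M"
    and gens: "eval (exp_derivation t D cx) p = fst q" "eval (exp_derivation t D cy) p = fst (snd q)"
      "eval (exp_derivation t D cz) p = snd (snd q)"
  shows "eval (exp_derivation t D f) p = eval f q"
proof (induction f rule: coord_ring_induct)
  case (const c)
  have "(D ^^ 1) (cconst c) = 0" using derivation_cconst[OF D(1)] by simp
  from eval_exp_derivation_eq_sum[OF D p this, of t] show ?case by (simp add: p q)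
qed (use gens q eval_exp_derivation_add[OF D p] eval_exp_derivation_mult[OF D p] in auto)

section \<open>The three flows in coordinates\<close>

text \<open>Reduces the computation of a flow to the exponentials of the coordinate functions. The map at
  time \<open>-t\<close> serves as the inverse, and \<open>exp (t D)\<close> itself witnesses that the time-\<open>t\<close> map is a
  morphism.\<close>

lemma flow_eq:
  assumes D: "derivation D" "locally_nilpotent D"
    and maps: "\<And>t p. p \<in> M \<Longrightarrow> \<Phi> t p \<in> M"
    and inverse: "\<And>t p. p \<in> M \<Longrightarrow> \<Phi> (- t) (\<Phi> t p) = p"
    and gens: "\<And>t p. p \<in> M \<Longrightarrow> (eval (exp_derivation t D cx) p,
      eval (exp_derivation t D cy) p, eval (exp_derivation t D cz) p) = \<Phi> t p"
  shows "flow D = range (\<lambda>t. restrict (\<Phi> t) M)"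
proof (intro equalityI subsetI)
  fix F assume "F \<in> flow D"
  then obtain t where F: "F \<in> carrier Aut_M"
    and t: "\<And>f p. p \<in> M \<Longrightarrow> eval f (F p) = eval (exp_derivation t D f) p"
    by (auto simp: flow_def)
  have B: "F \<in> Bij M" using F by (simp add: Aut_M_def algebraic_automorphisms_def)
  have "F = restrict (\<Phi> t) M"
  proof (rule extensionalityI[of _ M])
    show "F \<in> extensional M" using B by (simp add: Bij_def)
    fix p assume p: "p \<in> M"
    have Fp: "F p \<in> M" using B p Bij_imp_funcset by blast
    have "F p = (eval cx (F p), eval cy (F p), eval cz (F p))" using Fp by simp
    also have "\<dots> = \<Phi> t p" unfolding t[OF p] by (rule gens[OF p])
    finally show "F p = restrict (\<Phi> t) M p" using p by simp
  qed simp
  then show "F \<in> range (\<lambda>t. restrict (\<Phi> t) M)" by blast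
next
  fix F assume "F \<in> range (\<lambda>t. restrict (\<Phi> t) M)"
  then obtain t where F: "F = restrict (\<Phi> t) M" by blast
  have pull: "eval f (\<Phi> t p) = eval (exp_derivation t D f) p" if p: "p \<in> M" for f t p
    using eval_exp_derivation[OF D p maps[OF p, of t], of t f] gens[OF p, of t] by (metis fst_conv snd_conv)
  have inverse': "\<Phi> t (\<Phi> (- t) p) = p" if "p \<in> M" for p
    using inverse[OF that, of "- t"] by simp
  have bij: "bij_betw F M M"
    unfolding F by (rule bij_betw_byWitness[where f' = "\<Phi> (- t)"])
      (auto simp: maps inverse inverse')
  then have B: "F \<in> Bij M" by (simp add: Bij_def F)
  have inv: "inv_into M F p = \<Phi> (- t) p" if p: "p \<in> M" for p
    using bij p by (intro inv_into_f_eq) (auto simp: bij_betw_def F maps inverse')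
  have "morphism F"
    unfolding morphism_def F using maps pull by (auto intro!: exI[of _ "exp_derivation t D _"])
  moreover have "morphism (inv_into M F)"
    unfolding morphism_def using maps pull[of _ _ "- t"] inv
    by (auto intro!: exI[of _ "exp_derivation (- t) D _"])
  ultimately have "F \<in> carrier Aut_M" using B by (simp add: Aut_M_def algebraic_automorphisms_def)
  then show "F \<in> flow D" unfolding flow_def using pull by (auto simp: F)
qed

definition Theta_map :: "complex \<Rightarrow> point \<Rightarrow> point" where
  "Theta_map t = (\<lambda>(x, y, z). (x + 2 * t * z + t\<^sup>2 * y, y, z + t * y))"

definition Xi_map :: "complex \<Rightarrow> point \<Rightarrow> point" where
  "Xi_map t = (\<lambda>(x, y, z). (x, y + 2 * t * z + t\<^sup>2 * x, z + t * x))"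

lemma eval_2 [simp]: "p \<in> M \<Longrightarrow> eval 2 p = 2"
  using eval_of_nat[of p 2] by simp

lemma flow_Theta: "flow Theta = range (\<lambda>t. restrict (Theta_map t) M)"
proof (rule flow_eq[OF derivation_Theta locally_nilpotent_Theta])
  show "Theta_map t p \<in> M" if "p \<in> M" for t p
    using that by (auto simp: M_def Theta_map_def algebra_simps power2_eq_square)
  show "Theta_map (- t) (Theta_map t p) = p" if "p \<in> M" for t p
    by (auto simp: Theta_map_def algebra_simps power2_eq_square split: prod.splits)
  show "(eval (exp_derivation t Theta cx) p, eval (exp_derivation t Theta cy) p,
    eval (exp_derivation t Theta cz) p) = Theta_map t p" if p: "p \<in> M" for t p
  proof -
    note s = numeral_3_eq_3 derivation_two[OF derivation_Theta] derivation_zero[OF derivation_Theta]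
      derivation_mult[OF derivation_Theta] derivation_add[OF derivation_Theta]
    have "(Theta ^^ 3) cx = 0" "(Theta ^^ 3) cy = 0" "(Theta ^^ 3) cz = 0"
      by (simp_all add: s)
    note e = this[THEN eval_exp_derivation_eq_sum[OF derivation_Theta locally_nilpotent_Theta p]]
    show ?thesis
      by (simp add: e s Theta_map_def p split: prod.splits) (simp add: power2_eq_square)
  qed
qed

lemma flow_Xi: "flow Xi = range (\<lambda>t. restrict (Xi_map t) M)"
proof (rule flow_eq[OF derivation_Xi locally_nilpotent_Xi])
  show "Xi_map t p \<in> M" if "p \<in> M" for t p
    using that by (auto simp: M_def Xi_map_def algebra_simps power2_eq_square)
  show "Xi_map (- t) (Xi_map t p) = p" if "p \<in> M" for t p
    by (auto simp: Xi_map_def algebra_simps power2_eq_square split: prod.splits)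
  show "(eval (exp_derivation t Xi cx) p, eval (exp_derivation t Xi cy) p,
    eval (exp_derivation t Xi cz) p) = Xi_map t p" if p: "p \<in> M" for t p
  proof -
    note s = numeral_3_eq_3 derivation_two[OF derivation_Xi] derivation_zero[OF derivation_Xi]
      derivation_mult[OF derivation_Xi] derivation_add[OF derivation_Xi]
    have "(Xi ^^ 3) cx = 0" "(Xi ^^ 3) cy = 0" "(Xi ^^ 3) cz = 0"
      by (simp_all add: s)
    note e = this[THEN eval_exp_derivation_eq_sum[OF derivation_Xi locally_nilpotent_Xi p]]
    show ?thesis
      by (simp add: e s Xi_map_def p split: prod.splits) (simp add: power2_eq_square)
  qed
qed

text \<open>Since \<open>x\<close> is constant along \<open>\<Xi>\<close>, the field \<open>x \<Xi>\<close> follows the same trajectories with time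
  rescaled by the value of \<open>x\<close>.\<close>

lemma flow_x_Xi: "flow x_Xi = range (\<lambda>t. \<lambda>p\<in>M. Xi_map (t * fst p) p)"
proof (rule flow_eq[OF derivation_x_Xi locally_nilpotent_x_Xi])
  show "Xi_map (t * fst p) p \<in> M" if "p \<in> M" for t p
    using that by (auto simp: M_def Xi_map_def algebra_simps power2_eq_square)
  show "Xi_map (- t * fst (Xi_map (t * fst p) p)) (Xi_map (t * fst p) p) = p" if "p \<in> M" for t p
    by (auto simp: Xi_map_def algebra_simps power2_eq_square split: prod.splits)
  show "(eval (exp_derivation t x_Xi cx) p, eval (exp_derivation t x_Xi cy) p,
    eval (exp_derivation t x_Xi cz) p) = Xi_map (t * fst p) p" if p: "p \<in> M" for t p
  proof -
    note s = numeral_3_eq_3 derivation_two[OF derivation_Xi] derivation_zero[OF derivation_Xi]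
      derivation_mult[OF derivation_Xi] derivation_add[OF derivation_Xi] x_Xi_def
    have "(x_Xi ^^ 3) cx = 0" "(x_Xi ^^ 3) cy = 0" "(x_Xi ^^ 3) cz = 0"
      by (simp_all add: s)
    note e = this[THEN eval_exp_derivation_eq_sum[OF derivation_x_Xi locally_nilpotent_x_Xi p]]
    show ?thesis
      by (simp add: e s Xi_map_def p split: prod.splits) (simp add: power2_eq_square)
  qed
qed

section \<open>The group generated by the flows\<close>

definition flow_group :: "(point \<Rightarrow> point) monoid" where
  "flow_group = Aut_M\<lparr>carrier := generate Aut_M (flow Xi \<union> flow Theta \<union> flow x_Xi)\<rparr>"

lemma flow_subset_Aut_M: "flow D \<subseteq> carrier Aut_M"
  by (auto simp: flow_def)

lemma subgroup_flow_group: "subgroup (carrier flow_group) Aut_M"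
  unfolding flow_group_def using flow_subset_Aut_M
  by (auto intro!: group.generate_is_subgroup[OF group_Aut_M])

lemma flow_group_simps [simp]:
  "(\<otimes>\<^bsub>flow_group\<^esub>) = (\<otimes>\<^bsub>Aut_M\<^esub>)" "\<one>\<^bsub>flow_group\<^esub> = \<one>\<^bsub>Aut_M\<^esub>"
  by (simp_all add: flow_group_def)

lemma group_flow_group: "group flow_group"
  using subgroup.subgroup_is_group[OF subgroup_flow_group group_Aut_M]
  by (simp add: flow_group_def)

lemma flow_subset_flow_group:
  "flow Xi \<subseteq> carrier flow_group" "flow Theta \<subseteq> carrier flow_group" "flow x_Xi \<subseteq> carrier flow_group"
  by (auto simp: flow_group_def intro: generate.incl)

lemma Aut_M_Bij: "F \<in> carrier Aut_M \<Longrightarrow> F \<in> Bij M"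
  by (simp add: Aut_M_def algebraic_automorphisms_def)

lemma Aut_M_mult:
  "F \<in> carrier Aut_M \<Longrightarrow> H \<in> carrier Aut_M \<Longrightarrow> F \<otimes>\<^bsub>Aut_M\<^esub> H = compose M F H"
  by (simp add: Aut_M_def BijGroup_def algebraic_automorphisms_def)

lemma Aut_M_one: "\<one>\<^bsub>Aut_M\<^esub> = (\<lambda>p\<in>M. p)"
  by (simp add: Aut_M_def BijGroup_def)

lemma flow_group_Aut_M: "F \<in> carrier flow_group \<Longrightarrow> F \<in> carrier Aut_M"
  using subgroup.subset[OF subgroup_flow_group] by blast

lemma origin_in_M: "(0, 0, 0) \<in> M"
  by (simp add: M_def)

text \<open>This is why the regular locus is invariant.\<close>

lemma flow_group_fixes_origin:
  assumes "F \<in> carrier flow_group"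
  shows "F (0, 0, 0) = (0, 0, 0)"
proof -
  interpret group Aut_M by (rule group_Aut_M)
  have flows: "F (0, 0, 0) = (0, 0, 0)" if "F \<in> flow Xi \<union> flow Theta \<union> flow x_Xi" for F
    using that origin_in_M by (auto simp: flow_Xi flow_Theta flow_x_Xi Xi_map_def Theta_map_def)
  have "F \<in> generate Aut_M (flow Xi \<union> flow Theta \<union> flow x_Xi)"
    using assms by (simp add: flow_group_def)
  then show ?thesis
  proof (induction rule: generate.induct)
    case one
    show ?case using origin_in_M by (simp add: Aut_M_one)
  next
    case (incl F)
    then show ?case by (rule flows)
  next
    case (inv F)
    then have F: "F \<in> carrier Aut_M" using flow_subset_Aut_M by blast
    have "compose M (inv\<^bsub>Aut_M\<^esub> F) F (0, 0, 0) = (0, 0, 0)"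
      using l_inv[OF F] Aut_M_mult[OF inv_closed[OF F] F] origin_in_M by (simp add: Aut_M_one)
    then show ?case using flows[OF inv] origin_in_M by (simp add: compose_def)
  next
    case (eng F H)
    have "generate Aut_M (flow Xi \<union> flow Theta \<union> flow x_Xi) \<subseteq> carrier Aut_M"
      using subgroup.subset[OF subgroup_flow_group] by (simp add: flow_group_def)
    then have "F \<otimes>\<^bsub>Aut_M\<^esub> H = compose M F H" using eng.hyps by (intro Aut_M_mult) auto
    then show ?case using eng.IH origin_in_M by (simp add: compose_def)
  qed
qed

lemma restrict_flow_group_Bij:
  assumes "F \<in> carrier flow_group"
  shows "restrict F regular_locus \<in> Bij regular_locus"
proof -
  have F: "bij_betw F M M" using Aut_M_Bij flow_group_Aut_M assms by (auto simp: Bij_def)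
  have "F ` regular_locus = F ` M - F ` {(0, 0, 0)}"
    unfolding regular_locus_def using F origin_in_M
    by (intro inj_on_image_set_diff) (auto simp: bij_betw_def)
  then have "F ` regular_locus = regular_locus"
    using F flow_group_fixes_origin[OF assms] by (simp add: bij_betw_def regular_locus_def)
  moreover have "inj_on F regular_locus"
    using F by (auto simp: bij_betw_def regular_locus_def intro: inj_on_subset)
  ultimately show ?thesis by (simp add: Bij_def bij_betw_def)
qed

interpretation M_reg: group_action flow_group regular_locus "\<lambda>F. restrict F regular_locus"
proof (rule group_action.intro, unfold group_hom_def group_hom_axioms_def, intro conjI homI)
  show "group flow_group" by (rule group_flow_group)
  show "group (BijGroup regular_locus)" by (rule group_BijGroup)
  show "restrict F regular_locus \<in> carrier (BijGroup regular_locus)"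
    if "F \<in> carrier flow_group" for F
    using restrict_flow_group_Bij[OF that] by (simp add: BijGroup_def)
  fix F H assume F: "F \<in> carrier flow_group" and H: "H \<in> carrier flow_group"
  have "H p \<in> regular_locus" if "p \<in> regular_locus" for p
    using restrict_flow_group_Bij[OF H] that by (fastforce simp: Bij_def bij_betw_def)
  then have "restrict (compose M F H) regular_locus
      = compose regular_locus (restrict F regular_locus) (restrict H regular_locus)"
    by (auto simp: compose_def restrict_def regular_locus_def)
  then show "restrict (F \<otimes>\<^bsub>flow_group\<^esub> H) regular_locus
      = restrict F regular_locus \<otimes>\<^bsub>BijGroup regular_locus\<^esub> restrict H regular_locus"
    using restrict_flow_group_Bij F H Aut_M_mult flow_group_Aut_M by (simp add: BijGroup_def)
qed

section \<open>Lifting to the plane\<close>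

text \<open>The quotient map of the plane by \<open>\<plusminus>1\<close>. It turns the flows into shears, whose compositions are
  easy to compute.\<close>

definition cover :: "complex \<times> complex \<Rightarrow> point" where
  "cover = (\<lambda>(u, v). (u\<^sup>2, v\<^sup>2, u * v))"

lemma cover_in_M [simp]: "cover w \<in> M"
  by (auto simp: cover_def M_def power2_eq_square split: prod.splits)

lemma cover_in_regular_locus: "cover (u, v) \<in> regular_locus \<longleftrightarrow> (u, v) \<noteq> (0, 0)"
  using cover_in_M[of "(u, v)"] by (auto simp: regular_locus_def cover_def)

lemma cover_surj:
  assumes "p \<in> M"
  obtains u v where "p = cover (u, v)"
proof -
  obtain x y z where p: "p = (x, y, z)" "x * y = z\<^sup>2"
    using assms by (cases p) (auto simp: M_def)
  have "p = cover (csqrt x, if x = 0 then csqrt y else z / csqrt x)"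
    using p by (auto simp: cover_def power_divide field_simps)
  then show thesis by (rule that)
qed

definition liftable :: "(complex \<times> complex \<Rightarrow> complex \<times> complex) \<Rightarrow> bool" where
  "liftable g \<longleftrightarrow> (\<exists>F\<in>carrier flow_group. \<forall>w. F (cover w) = cover (g w))"

lemma liftable_comp:
  assumes "liftable g" "liftable h"
  shows "liftable (g \<circ> h)"
proof -
  obtain F where F: "F \<in> carrier flow_group" "\<forall>w. F (cover w) = cover (g w)"
    using assms(1) by (auto simp: liftable_def)
  obtain H where H: "H \<in> carrier flow_group" "\<forall>w. H (cover w) = cover (h w)"
    using assms(2) by (auto simp: liftable_def)
  have "compose M F H \<in> carrier flow_group"
    using M_reg.mult_carrier[OF F(1) H(1)] Aut_M_mult F(1) H(1) flow_group_Aut_M by simp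
  moreover have "\<forall>w. compose M F H (cover w) = cover ((g \<circ> h) w)"
    using F(2) H(2) by (simp add: compose_def del: split_paired_All)
  ultimately show ?thesis unfolding liftable_def by blast
qed

lemma Xi_map_cover: "Xi_map t (cover (u, v)) = cover (u, v + t * u)"
  by (simp add: Xi_map_def cover_def algebra_simps power2_eq_square)

lemma Theta_map_cover: "Theta_map t (cover (u, v)) = cover (u + t * v, v)"
  by (simp add: Theta_map_def cover_def algebra_simps power2_eq_square)

lemma liftable_Xi: "liftable (\<lambda>(u, v). (u, v + t * u))"
  unfolding liftable_def
proof (rule bexI)
  show "restrict (Xi_map t) M \<in> carrier flow_group"
    using flow_subset_flow_group(1) flow_Xi by blast
qed (auto simp: Xi_map_cover)

lemma liftable_Theta: "liftable (\<lambda>(u, v). (u + t * v, v))"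
  unfolding liftable_def
proof (rule bexI)
  show "restrict (Theta_map t) M \<in> carrier flow_group"
    using flow_subset_flow_group(2) flow_Theta by blast
qed (auto simp: Theta_map_cover)

lemma liftable_x_Xi: "liftable (\<lambda>(u, v). (u, v + t * u ^ 3))"
  unfolding liftable_def
proof (rule bexI)
  show "(\<lambda>p\<in>M. Xi_map (t * fst p) p) \<in> carrier flow_group"
    using flow_subset_flow_group(3) flow_x_Xi by blast
qed (auto simp: Xi_map_cover, auto simp: cover_def power2_eq_square power3_eq_cube algebra_simps)

lemma liftable_rotation: "liftable (\<lambda>(u, v). (v, - u))"
proof -
  have "liftable ((\<lambda>(u, v). (u + 1 * v, v)) \<circ> (\<lambda>(u, v). (u, v + (- 1) * u)) \<circ> (\<lambda>(u, v). (u + 1 * v, v)))"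
    by (intro liftable_comp liftable_Theta liftable_Xi)
  also have "(\<lambda>(u, v). (u + 1 * v, v)) \<circ> (\<lambda>(u, v). (u, v + (- 1) * u)) \<circ> (\<lambda>(u, v). (u + 1 * v, v))
      = (\<lambda>(u, v::complex). (v, - u))"
    by auto
  finally show ?thesis .
qed

lemma liftable_step: "liftable (\<lambda>(u, v). (v + s * u + t * u ^ 3, - u))"
proof -
  have "liftable ((\<lambda>(u, v). (v, - u)) \<circ> (\<lambda>(u, v). (u, v + t * u ^ 3)) \<circ> (\<lambda>(u, v). (u, v + s * u)))"
    by (intro liftable_comp liftable_rotation liftable_x_Xi liftable_Xi)
  also have "(\<lambda>(u, v). (v, - u)) \<circ> (\<lambda>(u, v). (u, v + t * u ^ 3)) \<circ> (\<lambda>(u, v). (u, v + s * u))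
      = (\<lambda>(u, v). (v + s * u + t * u ^ 3, - u))"
    by auto
  finally show ?thesis .
qed

lemma liftable_cubic_word: "liftable (\<lambda>(u, v). (cubic_word u v (Suc k), - cubic_word u v k))"
proof (induction k)
  case 0
  show ?case using liftable_rotation by simp
next
  case (Suc k)
  have "liftable ((\<lambda>(u, v). (v + 0 * u + 1 * u ^ 3, - u)) \<circ>
      (\<lambda>(u, v). (cubic_word u v (Suc k), - cubic_word u v k)))"
    by (intro liftable_comp liftable_step Suc)
  also have "(\<lambda>(u, v). (v + 0 * u + 1 * u ^ 3, - u)) \<circ>
      (\<lambda>(u, v). (cubic_word u v (Suc k), - cubic_word u v k)) =
      (\<lambda>(u, v::complex). (cubic_word u v (Suc (Suc k)), - cubic_word u v (Suc k)))"
    by auto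
  finally show ?case .
qed

definition word_value :: "nat \<Rightarrow> complex \<Rightarrow> complex \<Rightarrow> complex \<times> complex \<Rightarrow> complex" where
  "word_value k s t = (\<lambda>(u, v). t * cubic_word u v (Suc k) ^ 3 + s * cubic_word u v (Suc k) - cubic_word u v k)"

text \<open>The last step, with free parameters \<open>s\<close> and \<open>t\<close>, follows the rotation and \<open>k\<close> steps
  with parameters \<open>0\<close> and \<open>1\<close>.\<close>

lemma ex_flow_group_word:
  "\<exists>F\<in>carrier flow_group. \<exists>g. (\<forall>w. F (cover w) = cover (g w)) \<and> (\<forall>w. fst (g w) = word_value k s t w)"
proof -
  have "liftable ((\<lambda>(u, v). (v + s * u + t * u ^ 3, - u)) \<circ>
      (\<lambda>(u, v). (cubic_word u v (Suc k), - cubic_word u v k)))"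
    by (intro liftable_comp liftable_step liftable_cubic_word)
  then obtain F where F: "F \<in> carrier flow_group" "\<forall>w. F (cover w) = cover
      (((\<lambda>(u, v). (v + s * u + t * u ^ 3, - u)) \<circ> (\<lambda>(u, v). (cubic_word u v (Suc k), - cubic_word u v k))) w)"
    unfolding liftable_def by blast
  show ?thesis
    by (rule bexI[OF _ F(1)], rule exI, rule conjI[OF F(2)])
      (auto simp: word_value_def simp del: cubic_word.simps)
qed

section \<open>The curve \<open>x = 0\<close> and its sections\<close>

definition x_zero :: "point set" where
  "x_zero = {p \<in> regular_locus. fst p = 0}"

lemma cover_in_x_zero: "cover (u, v) \<in> x_zero \<longleftrightarrow> u = 0 \<and> v \<noteq> 0"
  by (auto simp: x_zero_def cover_in_regular_locus) (auto simp: cover_def)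

lemma Xi_fixes_x_zero:
  assumes "p \<in> x_zero"
  shows "Xi_map t p = p"
proof -
  have "p \<in> M" using assms by (simp add: x_zero_def regular_locus_def)
  then obtain u v where "p = cover (u, v)" by (rule cover_surj)
  then show ?thesis using assms by (simp add: cover_in_x_zero Xi_map_cover)
qed

text \<open>The flow of \<open>\<Xi>\<close> fixes the curve \<open>x = 0\<close> pointwise and is transitive on the level curve
  \<open>x = c\<^sup>2\<close>, the image of the line \<open>u = c\<close>.\<close>

lemma linked_level_curve:
  assumes S: "S \<subseteq> x_zero" and "c \<noteq> 0"
  shows "M_reg.linked S (cover (c, v)) (cover (c, v'))"
proof (rule M_reg.linkedI)
  show "restrict (Xi_map ((v' - v) / c)) M \<in> carrier flow_group"
    using flow_subset_flow_group(1) flow_Xi by blast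
  show "restrict (restrict (Xi_map ((v' - v) / c)) M) regular_locus p = p" if "p \<in> S" for p
  proof -
    have "p \<in> x_zero" "p \<in> regular_locus" "p \<in> M"
      using that S by (auto simp: x_zero_def regular_locus_def)
    then show ?thesis using Xi_fixes_x_zero by simp
  qed
  show "restrict (restrict (Xi_map ((v' - v) / c)) M) regular_locus (cover (c, v)) = cover (c, v')"
    using \<open>c \<noteq> 0\<close> by (simp add: cover_in_regular_locus Xi_map_cover)
qed

lemma word_value_on_x_zero:
  "word_value k s t (0, v) = v * poly (smult s (odd_word_factor (Suc k)) - odd_word_factor k
     + smult t ([:0, 1:] * odd_word_factor (Suc k) ^ 3)) (v\<^sup>2)"
  unfolding word_value_def
  by (simp add: cubic_word_0 algebra_simps power2_eq_square power3_eq_cube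
      del: cubic_word.simps odd_word_factor.simps)

lemma translate_section_word:
  assumes F: "F \<in> carrier flow_group" "\<And>w. F (cover w) = cover (g w)"
    and g: "\<And>w. fst (g w) = word_value k s t w"
  shows "M_reg.translate_section x_zero F = (\<lambda>y. (0, y, 0)) ` section_roots k s t"
proof -
  have "cover (0, v) \<in> M_reg.translate_section x_zero F \<longleftrightarrow> v\<^sup>2 \<in> section_roots k s t" for v
  proof (cases "v = 0")
    case True
    then show ?thesis by (simp add: M_reg.translate_section_def cover_in_x_zero section_roots_def)
  next
    case False
    then have reg: "cover (0, v) \<in> regular_locus" by (simp add: cover_in_regular_locus)
    then have "cover (g (0, v)) \<in> regular_locus"
      using M_reg.element_image[OF F(1), of "cover (0, v)"] F(2) by simp
    then have "cover (g (0, v)) \<in> x_zero \<longleftrightarrow> fst (g (0, v)) = 0"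
      by (cases "g (0, v)") (auto simp: x_zero_def cover_def)
    then show ?thesis
      using False reg F(2) g[of "(0, v)"]
      by (simp add: M_reg.translate_section_def cover_in_x_zero section_roots_def word_value_on_x_zero)
  qed
  note mem = this
  have on_line: "\<exists>v. p = cover (0, v)" if "p \<in> M_reg.translate_section x_zero F" for p :: point
  proof -
    have p: "p \<in> x_zero" using that by (simp add: M_reg.translate_section_def)
    then have "p \<in> M" by (simp add: x_zero_def regular_locus_def)
    then obtain u v where "p = cover (u, v)" by (rule cover_surj)
    then show ?thesis using p by (auto simp: cover_in_x_zero)
  qed
  have cover_0: "cover (0, v) = (0, v\<^sup>2, 0)" for v by (simp add: cover_def)
  show ?thesis
  proof (intro equalityI subsetI)
    fix p :: point assume p: "p \<in> M_reg.translate_section x_zero F"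
    then show "p \<in> (\<lambda>y. (0, y, 0)) ` section_roots k s t"
      using on_line[OF p] mem cover_0 by auto
  next
    fix p :: point assume "p \<in> (\<lambda>y. (0, y, 0)) ` section_roots k s t"
    then obtain y where y: "y \<in> section_roots k s t" "p = (0, y, 0)" by blast
    then show "p \<in> M_reg.translate_section x_zero F"
      using mem[of "csqrt y"] cover_0[of "csqrt y"] by simp
  qed
qed

text \<open>The stabiliser of the section contains the flow of \<open>\<Xi>\<close>, which links the points of each line
  \<open>u = c\<close>, and the conjugate of this flow by \<open>F\<close>, which links the points of each curve where the
  word takes a fixed nonzero value. Every such curve meets every line, because the word restricted to
  a line is surjective. A point outside the section lies on a line with \<open>c \<noteq> 0\<close> or on a curve with
  nonzero value, and so is linked to one base point on the line \<open>u = 1\<close>.\<close>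

lemma linked_off_translate_section:
  assumes F: "F \<in> carrier flow_group" "\<And>w. F (cover w) = cover (g w)"
    and g: "\<And>w. fst (g w) = word_value k s t w" and t: "t \<noteq> 0"
    and q: "q \<in> regular_locus - M_reg.translate_section x_zero F"
    and r: "r \<in> regular_locus - M_reg.translate_section x_zero F"
  shows "M_reg.linked (M_reg.translate_section x_zero F) q r"
proof -
  let ?S = "M_reg.translate_section x_zero F"
  let ?\<phi> = "\<lambda>p. restrict F regular_locus p"
  have S: "?S \<subseteq> x_zero" "?S \<subseteq> regular_locus" "?\<phi> ` ?S \<subseteq> x_zero"
    by (auto simp: M_reg.translate_section_def x_zero_def)
  \<comment> \<open>These curves are the preimages under \<open>F\<close> of the level curves of \<open>x\<close>.\<close>
  have word_curve: "M_reg.linked ?S (cover w) (cover w')"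
    if w: "word_value k s t w = d" "word_value k s t w' = d" "d \<noteq> 0"
      "cover w \<in> regular_locus" "cover w' \<in> regular_locus" for w w' d
  proof (rule M_reg.linked_translate[OF F(1) _ S(2) w(4,5)])
    obtain e e' where "g w = (d, e)" "g w' = (d, e')"
      using g[of w] g[of w'] w(1,2) by (metis prod.collapse)
    then show "M_reg.linked (?\<phi> ` ?S) (?\<phi> (cover w)) (?\<phi> (cover w'))"
      using linked_level_curve[OF S(3) w(3), of e e'] w(4,5) F(2) by simp
  qed
  have surj: "\<exists>v. word_value k s t (c, v) = d" for c d
    using cubic_word_surj[OF t, of c k s d] by (simp add: word_value_def del: cubic_word.simps)
  obtain v1 where v1: "word_value k s t (1, v1) = 1" using surj by blast
  have base: "M_reg.linked ?S q (cover (1, v1))" if "q \<in> regular_locus - ?S" for q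
  proof -
    have "q \<in> M" using that by (simp add: regular_locus_def)
    then obtain c e where qce: "q = cover (c, e)" by (rule cover_surj)
    show ?thesis
    proof (cases "c = 0")
      case False
      obtain v where v: "word_value k s t (c, v) = 1" using surj by blast
      have "M_reg.linked ?S q (cover (c, v))"
        unfolding qce by (rule linked_level_curve[OF S(1) False])
      moreover have "M_reg.linked ?S (cover (c, v)) (cover (1, v1))"
        by (rule word_curve[OF v v1]) (use False in \<open>auto simp: cover_in_regular_locus\<close>)
      ultimately show ?thesis using M_reg.linked_trans S(2) that by blast
    next
      case True
      have "word_value k s t (c, e) \<noteq> 0"
      proof
        assume "word_value k s t (c, e) = 0"
        then have "fst (cover (g (c, e))) = 0" using g[of "(c, e)"] by (auto simp: cover_def split: prod.splits)
        moreover have "cover (g (c, e)) \<in> regular_locus"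
          using M_reg.element_image[OF F(1), of q] that F(2) qce by simp
        ultimately have "q \<in> ?S"
          using that True by (auto simp: M_reg.translate_section_def x_zero_def qce F(2)) (simp add: cover_def)
        then show False using that by blast
      qed
      moreover obtain v where v: "word_value k s t (1, v) = word_value k s t (c, e)" using surj by blast
      ultimately have "M_reg.linked ?S q (cover (1, v))"
        unfolding qce using that qce by (intro word_curve[OF refl v]) (auto simp: cover_in_regular_locus)
      moreover have "M_reg.linked ?S (cover (1, v)) (cover (1, v1))"
        by (rule linked_level_curve[OF S(1)]) simp
      ultimately show ?thesis using M_reg.linked_trans S(2) that by blast
    qed
  qed
  show ?thesis
    using M_reg.linked_trans[OF base[OF q] M_reg.linked_sym[OF base[OF r] S(2)] S(2)] q r by blast
qed

section \<open>Infinite transitivity on the regular locus\<close>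

theorem theorem28:
  shows "infinitely_transitive_action
    (Aut_M\<lparr>carrier := generate Aut_M (flow Xi \<union> flow Theta \<union> flow x_Xi)\<rparr>)
    regular_locus
    (\<lambda>F. restrict F regular_locus)"
  unfolding flow_group_def[symmetric]
proof (rule M_reg.infinitely_transitive_if_sections[where L = x_zero and K = "flow Xi"])
  show "x_zero \<subseteq> regular_locus" by (auto simp: x_zero_def)
  show "flow Xi \<subseteq> carrier flow_group" by (rule flow_subset_flow_group)
  show "restrict F regular_locus p = p" if F: "F \<in> flow Xi" and p: "p \<in> x_zero" for F p
  proof -
    obtain t where "F = restrict (Xi_map t) M" using F by (auto simp: flow_Xi)
    moreover have "p \<in> regular_locus" "p \<in> M"
      using p by (simp_all add: x_zero_def regular_locus_def)
    ultimately show ?thesis using Xi_fixes_x_zero[OF p] by simp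
  qed
next
  fix q assume q: "q \<in> regular_locus - x_zero"
  then have "q \<in> M" by (simp add: regular_locus_def)
  then obtain u v where uv: "q = cover (u, v)" by (rule cover_surj)
  have u: "u \<noteq> 0" using q by (auto simp: uv cover_in_x_zero cover_in_regular_locus)
  have "inj (\<lambda>t. cover (u, v + t * u))"
    using u by (auto simp: inj_def cover_def)
  then have "infinite (range (\<lambda>t. cover (u, v + t * u)))"
    using infinite_UNIV_char_0[where 'a = complex] by (metis finite_imageD)
  moreover have "range (\<lambda>t. cover (u, v + t * u)) \<subseteq> {restrict F regular_locus q |F. F \<in> flow Xi}"
  proof (rule image_subsetI)
    fix t
    have "cover (u, v + t * u) = restrict (restrict (Xi_map t) M) regular_locus q"
      using q by (simp add: uv Xi_map_cover)
    then show "cover (u, v + t * u) \<in> {restrict F regular_locus q |F. F \<in> flow Xi}"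
      using flow_Xi by blast
  qed
  ultimately show "infinite {restrict F regular_locus q |F. F \<in> flow Xi}"
    using finite_subset by blast
next
  fix q assume q: "q \<in> regular_locus"
  show "\<exists>F\<in>carrier flow_group. restrict F regular_locus q \<notin> x_zero"
  proof (cases "q \<in> x_zero")
    case False
    then show ?thesis using M_reg.one_act q by metis
  next
    case True
    obtain u v where uv: "q = cover (u, v)" using q cover_surj unfolding regular_locus_def by blast
    obtain F where F: "F \<in> carrier flow_group" "\<forall>w. F (cover w) = cover ((\<lambda>(u, v). (u + 1 * v, v)) w)"
      using liftable_Theta[of 1] unfolding liftable_def by blast
    then show ?thesis using True q by (intro bexI[OF _ F(1)]) (auto simp: uv cover_in_x_zero)
  qed
next
  fix n
  obtain k t t' where t: "t \<noteq> 0" and fin: "finite (section_roots k 0 t)"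
    and card: "n \<le> card (section_roots k 0 t)"
      "card (section_roots k 1 t') = Suc (card (section_roots k 0 t))"
    using ex_section_roots_consecutive[of n] by blast
  obtain F g where F: "F \<in> carrier flow_group" "\<And>w. F (cover w) = cover (g w)"
    "\<And>w. fst (g w) = word_value k 0 t w"
    using ex_flow_group_word[of k 0 t] by blast
  obtain H h where H: "H \<in> carrier flow_group" "\<And>w. H (cover w) = cover (h w)"
    "\<And>w. fst (h w) = word_value k 1 t' w"
    using ex_flow_group_word[of k 1 t'] by blast
  have inj: "inj_on (\<lambda>y. (0, y, 0)) A" for A :: "complex set" by (simp add: inj_on_def)
  show "\<exists>F\<in>carrier flow_group. \<exists>H\<in>carrier flow_group.
      finite (M_reg.translate_section x_zero F) \<and> n \<le> card (M_reg.translate_section x_zero F) \<and>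
      card (M_reg.translate_section x_zero H) = Suc (card (M_reg.translate_section x_zero F)) \<and>
      (\<forall>q\<in>regular_locus - M_reg.translate_section x_zero F.
         \<forall>r\<in>regular_locus - M_reg.translate_section x_zero F.
           M_reg.linked (M_reg.translate_section x_zero F) q r)"
    using F(1) H(1) fin card linked_off_translate_section[OF F t]
    by (intro bexI[of _ F] bexI[of _ H])
      (simp_all add: translate_section_word[OF F] translate_section_word[OF H] card_image[OF inj])
qed

end
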